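(* Let $n\geq 2$ be an integer. The algebra $\mathcal{B}_{C_n}$ is finite-dimensional if and only if $n\leq 4$.
   Context: Let $k$ be a field of characteristic zero containing a primitive $n$-th root of unity $\xi$, and let $C_n$ be the cyclic group of order $n$ with generator $g$. Let $Y_{C_n}$ be the Yetter--Drinfeld module over $kC_n$ with basis $s_1,\ldots,s_{n-1}$, action $g\cdot s_i=\xi s_i$ and coaction (grading) $\delta(s_i)=g^i\otimes s_i$. Its braiding is $\Psi(s_i\otimes s_j)=(g^i\cdot s_j)\otimes s_i=\xi^i s_j\otimes s_i$. $\mathcal{B}_{C_n}:=\mathcal{B}(Y_{C_n})$ denotes the Nichols algebra of $Y_{C_n}$, i.e. the quotient of the tensor algebra $T(Y_{C_n})$, with its braided Hopf algebra structure in which $Y_{C_n}$ is primitive, by the largest graded Hopf ideal generated by homogeneous elements of degree at least $2$. *)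

theory Defs
  imports "HOL-Library.Poly_Mapping" "HOL-Algebra.QuotRing" "HOL-Algebra.Embedded_Algebras"
begin

text \<open>Words form a monoid under concatenation, so \<open>nat list \<Rightarrow>\<^sub>0 'k\<close> with the convolution
  product of \<open>Poly_Mapping\<close> is the free associative \<open>'k\<close>-algebra on letters \<open>s\<^sub>0, s\<^sub>1, \<dots>\<close>.\<close>

instantiation list :: (type) monoid_add
begin
definition zero_list :: "'a list" where "zero_list = []"
definition plus_list :: "'a list \<Rightarrow> 'a list \<Rightarrow> 'a list" where "plus_list = (@)"
instance by standard (simp_all add: zero_list_def plus_list_def)
end

definition scale :: "'k::field \<Rightarrow> ('w \<Rightarrow>\<^sub>0 'k) \<Rightarrow> ('w \<Rightarrow>\<^sub>0 'k)" where
  "scale c = Poly_Mapping.map ((*) c)"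

lemma lookup_scale [simp]: "Poly_Mapping.lookup (scale c a) w = c * Poly_Mapping.lookup a w"
  by (simp add: scale_def Poly_Mapping.map.rep_eq when_def)

global_interpretation pm: vector_space "scale :: 'k::field \<Rightarrow> ('w \<Rightarrow>\<^sub>0 'k) \<Rightarrow> _"
  by standard (auto intro!: poly_mapping_eqI simp: lookup_add algebra_simps)

definition lin_ext :: "('w \<Rightarrow> ('v \<Rightarrow>\<^sub>0 'k::field)) \<Rightarrow> ('w \<Rightarrow>\<^sub>0 'k) \<Rightarrow> ('v \<Rightarrow>\<^sub>0 'k)" where
  "lin_ext f a = (\<Sum>w\<in>Poly_Mapping.keys a. scale (Poly_Mapping.lookup a w) (f w))"

text \<open>\<open>V \<otimes> W\<close> for \<open>V\<close>, \<open>W\<close> with bases \<open>'v\<close>, \<open>'w\<close> is the space with basis \<open>'v \<times> 'w\<close>.\<close>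

definition tens :: "('v \<Rightarrow>\<^sub>0 'k::field) \<Rightarrow> ('w \<Rightarrow>\<^sub>0 'k) \<Rightarrow> ('v \<times> 'w \<Rightarrow>\<^sub>0 'k)" where
  "tens a b = lin_ext (\<lambda>u. lin_ext (\<lambda>v. Poly_Mapping.single (u, v) 1) b) a"

definition word :: "nat list \<Rightarrow> (nat list \<Rightarrow>\<^sub>0 'k::field)" where
  "word w = Poly_Mapping.single w 1"

text \<open>The tensor algebra of the span of \<open>s\<^sub>1, \<dots>, s\<^bsub>n-1\<^esub>\<close>.\<close>

definition tensor_algebra :: "nat \<Rightarrow> (nat list \<Rightarrow>\<^sub>0 'k::field) ring" where
  "tensor_algebra n =
     \<lparr>carrier = {a. Poly_Mapping.keys a \<subseteq> lists {1..<n}}, mult = (*), one = 1, zero = 0, add = (+)\<rparr>"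

definition homogeneous :: "nat \<Rightarrow> nat \<Rightarrow> (nat list \<Rightarrow>\<^sub>0 'k::field) set" where
  "homogeneous n d = {a \<in> carrier (tensor_algebra n). \<forall>w\<in>Poly_Mapping.keys a. length w = d}"

text \<open>The Yetter--Drinfeld structure on \<open>T(Y)\<close>, where \<open>Y\<close> has \<open>g \<cdot> s\<^sub>i = \<xi> s\<^sub>i\<close> and
  \<open>\<delta>(s\<^sub>i) = g\<^sup>i \<otimes> s\<^sub>i\<close>: the group acts diagonally and the \<open>C\<^sub>n\<close>-degrees add up.  An element
  \<open>g\<^sup>m\<close> of \<open>C\<^sub>n\<close> is represented by the exponent \<open>m\<close>.\<close>

definition act :: "'k::field \<Rightarrow> nat \<Rightarrow> (nat list \<Rightarrow>\<^sub>0 'k) \<Rightarrow> (nat list \<Rightarrow>\<^sub>0 'k)" where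
  "act \<xi> m = lin_ext (\<lambda>w. scale (\<Prod>_\<leftarrow>w. \<xi> ^ m) (word w))"

definition cdeg :: "nat \<Rightarrow> nat list \<Rightarrow> nat" where
  "cdeg n w = sum_list w mod n"

definition ccomp :: "nat \<Rightarrow> nat \<Rightarrow> (nat list \<Rightarrow>\<^sub>0 'k::field) \<Rightarrow> (nat list \<Rightarrow>\<^sub>0 'k)" where
  "ccomp n h = lin_ext (\<lambda>w. if cdeg n w = h then word w else 0)"

text \<open>\<open>\<Psi>(u \<otimes> v) = (g\<^bsup>deg u\<^esup> \<cdot> v) \<otimes> u\<close>\<close>

definition braiding ::
    "nat \<Rightarrow> 'k::field \<Rightarrow> (nat list \<times> nat list \<Rightarrow>\<^sub>0 'k) \<Rightarrow> (nat list \<times> nat list \<Rightarrow>\<^sub>0 'k)" where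
  "braiding n \<xi> = lin_ext (\<lambda>(u, v). tens (act \<xi> (cdeg n u) (word v)) (word u))"

text \<open>The product \<open>(m \<otimes> m)(id \<otimes> \<Psi> \<otimes> id)\<close> of the braided tensor square \<open>T(Y) \<otimes> T(Y)\<close>.\<close>

definition bmult :: "nat \<Rightarrow> 'k::field \<Rightarrow> (nat list \<times> nat list \<Rightarrow>\<^sub>0 'k) \<Rightarrow>
    (nat list \<times> nat list \<Rightarrow>\<^sub>0 'k) \<Rightarrow> (nat list \<times> nat list \<Rightarrow>\<^sub>0 'k)" where
  "bmult n \<xi> x y =
     lin_ext (\<lambda>(u, v). lin_ext (\<lambda>(u', v').
       lin_ext (\<lambda>(p, q). tens (word u * word p) (word q * word v'))
         (braiding n \<xi> (tens (word v) (word u')))) y) x"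

text \<open>\<open>\<Delta>\<close> is the algebra map into the braided tensor square for which every \<open>s\<^sub>i\<close> is primitive;
  the antipode satisfies \<open>S m = m \<Psi> (S \<otimes> S)\<close>.\<close>

primrec comult_word :: "nat \<Rightarrow> 'k::field \<Rightarrow> nat list \<Rightarrow> (nat list \<times> nat list \<Rightarrow>\<^sub>0 'k)" where
  "comult_word n \<xi> [] = tens 1 1"
| "comult_word n \<xi> (i # w) = bmult n \<xi> (tens (word [i]) 1 + tens 1 (word [i])) (comult_word n \<xi> w)"

definition comult :: "nat \<Rightarrow> 'k::field \<Rightarrow> (nat list \<Rightarrow>\<^sub>0 'k) \<Rightarrow> (nat list \<times> nat list \<Rightarrow>\<^sub>0 'k)" where
  "comult n \<xi> = lin_ext (comult_word n \<xi>)"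

definition counit :: "(nat list \<Rightarrow>\<^sub>0 'k::field) \<Rightarrow> 'k" where
  "counit a = Poly_Mapping.lookup a []"

definition mult_map :: "(nat list \<times> nat list \<Rightarrow>\<^sub>0 'k::field) \<Rightarrow> (nat list \<Rightarrow>\<^sub>0 'k)" where
  "mult_map = lin_ext (\<lambda>(u, v). word u * word v)"

primrec antipode_word :: "nat \<Rightarrow> 'k::field \<Rightarrow> nat list \<Rightarrow> (nat list \<Rightarrow>\<^sub>0 'k)" where
  "antipode_word n \<xi> [] = 1"
| "antipode_word n \<xi> (i # w) =
     mult_map (braiding n \<xi> (tens (- word [i]) (antipode_word n \<xi> w)))"

definition antipode :: "nat \<Rightarrow> 'k::field \<Rightarrow> (nat list \<Rightarrow>\<^sub>0 'k) \<Rightarrow> (nat list \<Rightarrow>\<^sub>0 'k)" where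
  "antipode n \<xi> = lin_ext (antipode_word n \<xi>)"

definition tens_sub :: "('v \<Rightarrow>\<^sub>0 'k::field) set \<Rightarrow> ('w \<Rightarrow>\<^sub>0 'k) set \<Rightarrow> ('v \<times> 'w \<Rightarrow>\<^sub>0 'k) set" where
  "tens_sub A B = pm.span {tens a b |a b. a \<in> A \<and> b \<in> B}"

text \<open>Hopf ideals of \<open>T(Y)\<close> in the Yetter--Drinfeld category generated by homogeneous elements
  of degree at least 2.  Being generated by homogeneous elements is what makes them graded.\<close>

definition graded_hopf_ideal :: "nat \<Rightarrow> 'k::field \<Rightarrow> (nat list \<Rightarrow>\<^sub>0 'k) set \<Rightarrow> bool" where
  "graded_hopf_ideal n \<xi> I \<longleftrightarrow>
     (\<exists>G \<subseteq> (\<Union>d\<in>{2..}. homogeneous n d). I = Idl\<^bsub>tensor_algebra n\<^esub> G) \<and>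
     (\<forall>a\<in>I. \<forall>m. act \<xi> m a \<in> I) \<and>
     (\<forall>a\<in>I. \<forall>h<n. ccomp n h a \<in> I) \<and>
     (\<forall>a\<in>I. comult n \<xi> a \<in> pm.span (tens_sub I (carrier (tensor_algebra n)) \<union>
                                     tens_sub (carrier (tensor_algebra n)) I)) \<and>
     (\<forall>a\<in>I. counit a = 0) \<and>
     (\<forall>a\<in>I. antipode n \<xi> a \<in> I)"

text \<open>The sum of all these ideals; by \<open>nichols_ideal_greatest\<close> below it is the largest one.\<close>

definition nichols_ideal :: "nat \<Rightarrow> 'k::field \<Rightarrow> (nat list \<Rightarrow>\<^sub>0 'k) set" where
  "nichols_ideal n \<xi> = pm.span (\<Union>{I. graded_hopf_ideal n \<xi> I})"

definition nichols_algebra :: "nat \<Rightarrow> 'k::field \<Rightarrow> (nat list \<Rightarrow>\<^sub>0 'k) set ring" where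
  "nichols_algebra n \<xi> = tensor_algebra n Quot nichols_ideal n \<xi>"

definition nichols_scalars :: "nat \<Rightarrow> 'k::field \<Rightarrow> (nat list \<Rightarrow>\<^sub>0 'k) set set" where
  "nichols_scalars n \<xi> =
     (\<lambda>c. nichols_ideal n \<xi> +>\<^bsub>tensor_algebra n\<^esub> scale c 1) ` UNIV"

lemma lin_ext_superset:
  assumes "finite S" "Poly_Mapping.keys a \<subseteq> S"
  shows "lin_ext f a = (\<Sum>w\<in>S. scale (Poly_Mapping.lookup a w) (f w))"
  unfolding lin_ext_def using assms
  by (intro sum.mono_neutral_left) (auto simp: in_keys_iff)

lemma lin_ext_add: "lin_ext f (a + b) = lin_ext f a + lin_ext f b"
proof -
  let ?S = "Poly_Mapping.keys a \<union> Poly_Mapping.keys b"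
  have "Poly_Mapping.keys (a + b) \<subseteq> ?S"
    by (rule Poly_Mapping.keys_add)
  then show ?thesis
    by (simp add: lin_ext_superset[of ?S] lookup_add pm.scale_left_distrib sum.distrib)
qed

lemma lin_ext_scale: "lin_ext f (scale c a) = scale c (lin_ext f a)"
proof -
  have "Poly_Mapping.keys (scale c a) \<subseteq> Poly_Mapping.keys a"
    by (auto simp: in_keys_iff)
  then show ?thesis
    by (simp add: lin_ext_superset[of "Poly_Mapping.keys a"] pm.scale_sum_right)
qed

lemma lin_ext_zero: "lin_ext f 0 = 0"
  by (simp add: lin_ext_def)

lemma lin_ext_single: "lin_ext f (Poly_Mapping.single w c) = scale c (f w)"
  by (simp add: lin_ext_superset[of "{w}"])

lemma lin_ext_uminus: "lin_ext f (- a) = - lin_ext f a"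
  using lin_ext_scale[of f "-1" a] by simp

lemma lin_ext_span:
  assumes "a \<in> pm.span X" "pm.subspace J" "\<And>x. x \<in> X \<Longrightarrow> lin_ext f x \<in> J"
  shows "lin_ext f a \<in> J"
  using assms(1)
proof (rule pm.span_induct)
  show "pm.subspace {a. lin_ext f a \<in> J}"
    using assms(2) by (auto simp: pm.subspace_def lin_ext_add lin_ext_scale lin_ext_zero)
qed (use assms(3) in auto)

lemma scale_mult: "scale c a * b = scale c (a * b)" "a * scale c b = scale c (a * b)"
  for a b :: "nat list \<Rightarrow>\<^sub>0 'k::field"
proof -
  have s: "scale c x = Poly_Mapping.single 0 c * x \<and> scale c x = x * Poly_Mapping.single 0 c"
    for x :: "nat list \<Rightarrow>\<^sub>0 'k"
  proof (induction x rule: update_induct)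
    case const
    show ?case by simp
  next
    case (update f k v)
    have u: "Poly_Mapping.update k v f = f + Poly_Mapping.single k v"
      using update(1)
      by (intro poly_mapping_eqI)
        (auto simp: lookup_update lookup_add lookup_single when_def in_keys_iff)
    have v: "scale c (Poly_Mapping.single k v) = Poly_Mapping.single k (c * v)"
      by (rule poly_mapping_eqI) (simp add: lookup_single when_def)
    have "Poly_Mapping.single 0 c * Poly_Mapping.single k v = scale c (Poly_Mapping.single k v)"
      "Poly_Mapping.single k v * Poly_Mapping.single 0 c = scale c (Poly_Mapping.single k v)"
      unfolding v by (simp_all add: mult_single mult.commute)
    then show ?case
      using update(3) unfolding u pm.scale_right_distrib distrib_left distrib_right by metis
  qed
  note s = conjunct1[OF s] conjunct2[OF s]
  show "scale c a * b = scale c (a * b)"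
    unfolding s(1)[of a] s(1)[of "a * b"] by (rule mult.assoc)
  show "a * scale c b = scale c (a * b)"
    unfolding s(2)[of b] s(2)[of "a * b"] by (rule mult.assoc[symmetric])
qed

lemma ta_simps:
  "carrier (tensor_algebra n) = {a. Poly_Mapping.keys a \<subseteq> lists {1..<n}}"
  "mult (tensor_algebra n) = (*)" "one (tensor_algebra n) = 1"
  "zero (tensor_algebra n) = 0" "add (tensor_algebra n) = (+)"
  by (simp_all add: tensor_algebra_def)

lemma subspace_keys: "pm.subspace {a :: 'w \<Rightarrow>\<^sub>0 'k::field. Poly_Mapping.keys a \<subseteq> A}"
proof (rule pm.subspaceI)
  fix a b :: "'w \<Rightarrow>\<^sub>0 'k" and c
  assume a: "a \<in> {a. Poly_Mapping.keys a \<subseteq> A}"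
  have "Poly_Mapping.keys (scale c a) \<subseteq> Poly_Mapping.keys a"
    by (auto simp: in_keys_iff)
  then show "scale c a \<in> {a. Poly_Mapping.keys a \<subseteq> A}"
    using a by blast
  assume "b \<in> {a. Poly_Mapping.keys a \<subseteq> A}"
  then show "a + b \<in> {a. Poly_Mapping.keys a \<subseteq> A}"
    using a Poly_Mapping.keys_add[of a b] by blast
qed simp

lemma subspace_ta: "pm.subspace (carrier (tensor_algebra n))"
  unfolding ta_simps by (rule subspace_keys)

lemma ta_mult_closed:
  assumes "a \<in> carrier (tensor_algebra n)" "b \<in> carrier (tensor_algebra n)"
  shows "a * b \<in> carrier (tensor_algebra n)"
  using assms keys_mult[of a b] unfolding ta_simps by (fastforce simp: plus_list_def)

lemma ta_one_closed: "1 \<in> carrier (tensor_algebra n)"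
  unfolding ta_simps by (simp add: zero_list_def flip: single_one)

lemma ring_tensor_algebra: "ring (tensor_algebra n :: (nat list \<Rightarrow>\<^sub>0 'k::field) ring)"
proof (rule ringI)
  let ?T = "tensor_algebra n :: (nat list \<Rightarrow>\<^sub>0 'k) ring"
  show "abelian_group ?T"
  proof (rule abelian_groupI)
    fix x assume "x \<in> carrier ?T"
    then show "\<exists>y\<in>carrier ?T. y \<oplus>\<^bsub>?T\<^esub> x = \<zero>\<^bsub>?T\<^esub>"
      by (intro bexI[of _ "- x"]) (auto simp: ta_simps(2-) pm.subspace_neg subspace_ta)
  qed (auto simp: ta_simps(2-) pm.subspace_add pm.subspace_0 subspace_ta add_ac)
  show "Group.monoid ?T"
    by (rule monoidI) (auto simp: ta_simps(2-) ta_mult_closed ta_one_closed mult.assoc)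
  fix x y z assume "x \<in> carrier ?T" "y \<in> carrier ?T" "z \<in> carrier ?T"
  show "(x \<oplus>\<^bsub>?T\<^esub> y) \<otimes>\<^bsub>?T\<^esub> z = x \<otimes>\<^bsub>?T\<^esub> z \<oplus>\<^bsub>?T\<^esub> y \<otimes>\<^bsub>?T\<^esub> z"
    "z \<otimes>\<^bsub>?T\<^esub> (x \<oplus>\<^bsub>?T\<^esub> y) = z \<otimes>\<^bsub>?T\<^esub> x \<oplus>\<^bsub>?T\<^esub> z \<otimes>\<^bsub>?T\<^esub> y"
    by (simp_all only: ta_simps(2-) distrib_left distrib_right)
qed

lemma subspace_ideal:
  assumes "ideal J (tensor_algebra n)"
  shows "pm.subspace J"
proof -
  interpret ideal J "tensor_algebra n" by fact
  have "scale c a \<in> J" if "a \<in> J" for c a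
  proof -
    have "scale c 1 \<in> carrier (tensor_algebra n)"
      using pm.subspace_scale[OF subspace_ta ta_one_closed] .
    then have "scale c 1 * a \<in> J"
      using I_l_closed[OF that, of "scale c 1"] by (simp add: ta_simps(2-))
    then show ?thesis by (simp add: scale_mult)
  qed
  moreover have "0 \<in> J" "\<And>a b. a \<in> J \<Longrightarrow> b \<in> J \<Longrightarrow> a + b \<in> J"
    using additive_subgroup.zero_closed[OF is_additive_subgroup]
      additive_subgroup.a_closed[OF is_additive_subgroup]
    by (auto simp: ta_simps(2-))
  ultimately show ?thesis
    by (auto simp: pm.subspace_def)
qed

lemma ideal_subspace:
  assumes "pm.subspace J" "J \<subseteq> carrier (tensor_algebra n)"
    "\<And>a x. a \<in> J \<Longrightarrow> x \<in> carrier (tensor_algebra n) \<Longrightarrow> x * a \<in> J"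
    "\<And>a x. a \<in> J \<Longrightarrow> x \<in> carrier (tensor_algebra n) \<Longrightarrow> a * x \<in> J"
  shows "ideal J (tensor_algebra n)"
proof (rule idealI)
  interpret ring "tensor_algebra n" by (rule ring_tensor_algebra)
  have "- a \<in> J" if "a \<in> J" for a
    using assms(1) that by (rule pm.subspace_neg)
  moreover have "\<ominus>\<^bsub>tensor_algebra n\<^esub> a = - a" if a: "a \<in> J" for a
  proof (rule minus_equality)
    show "- a \<oplus>\<^bsub>tensor_algebra n\<^esub> a = \<zero>\<^bsub>tensor_algebra n\<^esub>"
      by (simp add: ta_simps(2-))
    show "a \<in> carrier (tensor_algebra n)" "- a \<in> carrier (tensor_algebra n)"
      using a pm.subspace_neg[OF assms(1) a] assms(2) by blast+
  qed
  moreover have "J \<noteq> {}"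
    using pm.subspace_0[OF assms(1)] by blast
  moreover have "a \<oplus>\<^bsub>tensor_algebra n\<^esub> b \<in> J" if "a \<in> J" "b \<in> J" for a b
    using pm.subspace_add[OF assms(1) that] by (simp add: ta_simps(2-))
  ultimately show "subgroup J (add_monoid (tensor_algebra n))"
    using assms(2) by (intro add.subgroupI) (simp_all flip: a_inv_def)
qed (use assms ring_tensor_algebra in \<open>simp_all add: ta_simps(2-)\<close>)

lemma ideal_graded_hopf_ideal:
  assumes "graded_hopf_ideal n \<xi> J"
  shows "ideal J (tensor_algebra n)"
proof -
  interpret ring "tensor_algebra n" by (rule ring_tensor_algebra)
  show ?thesis
    using assms unfolding graded_hopf_ideal_def homogeneous_def by (auto intro!: genideal_ideal)
qed

lemma ideal_nichols_ideal:
  fixes \<xi> :: "'k::field"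
  shows "ideal (nichols_ideal n \<xi>) (tensor_algebra n)"
proof (rule ideal_subspace)
  let ?U = "\<Union>{I. graded_hopf_ideal n \<xi> I}"
  have U: "?U \<subseteq> carrier (tensor_algebra n)"
    using ideal.Icarr[OF ideal_graded_hopf_ideal] by blast
  show "pm.subspace (nichols_ideal n \<xi>)"
    by (simp add: nichols_ideal_def)
  show "nichols_ideal n \<xi> \<subseteq> carrier (tensor_algebra n)"
    unfolding nichols_ideal_def by (rule pm.span_minimal[OF U subspace_ta])
  fix a x :: "nat list \<Rightarrow>\<^sub>0 'k"
  assume a: "a \<in> nichols_ideal n \<xi>" and x: "x \<in> carrier (tensor_algebra n)"
  have *: "x * y \<in> nichols_ideal n \<xi>" "y * x \<in> nichols_ideal n \<xi>" if "y \<in> ?U" for y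
    using that x ideal.I_l_closed[OF ideal_graded_hopf_ideal] ideal.I_r_closed[OF ideal_graded_hopf_ideal]
    unfolding nichols_ideal_def by (fastforce simp: ta_simps(2-) intro: pm.span_base)+
  show "x * a \<in> nichols_ideal n \<xi>"
    using a[unfolded nichols_ideal_def]
  proof (rule pm.span_induct)
    show "pm.subspace {a. x * a \<in> nichols_ideal n \<xi>}"
      by (simp add: pm.subspace_def nichols_ideal_def distrib_left scale_mult
          pm.span_add pm.span_scale pm.span_zero)
  qed (use * in auto)
  show "a * x \<in> nichols_ideal n \<xi>"
    using a[unfolded nichols_ideal_def]
  proof (rule pm.span_induct)
    show "pm.subspace {a. a * x \<in> nichols_ideal n \<xi>}"
      by (simp add: pm.subspace_def nichols_ideal_def distrib_right scale_mult
          pm.span_add pm.span_scale pm.span_zero)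
  qed (use * in auto)
qed

theorem nichols_ideal_greatest:
  fixes \<xi> :: "'k::field"
  shows "graded_hopf_ideal n \<xi> (nichols_ideal n \<xi>)"
    and "graded_hopf_ideal n \<xi> I \<Longrightarrow> I \<subseteq> nichols_ideal n \<xi>"
proof -
  let ?T = "tensor_algebra n :: (nat list \<Rightarrow>\<^sub>0 'k) ring"
  let ?U = "\<Union>{I. graded_hopf_ideal n \<xi> I}"
  let ?N = "nichols_ideal n \<xi>"
  let ?H = "\<Union>d\<in>{2..}. homogeneous n d"
  interpret T: ring ?T by (rule ring_tensor_algebra)
  have sub: "J \<subseteq> ?N" if "graded_hopf_ideal n \<xi> J" for J
    using that pm.span_superset[of ?U] unfolding nichols_ideal_def by blast
  then show "graded_hopf_ideal n \<xi> I \<Longrightarrow> I \<subseteq> ?N" .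
  have sN: "pm.subspace ?N" by (simp add: nichols_ideal_def)
  have H: "?H \<subseteq> carrier ?T" by (auto simp: homogeneous_def)
  define G where "G = ?N \<inter> ?H"
  have "Idl\<^bsub>?T\<^esub> G \<subseteq> ?N"
    by (rule T.genideal_minimal[OF ideal_nichols_ideal]) (auto simp: G_def)
  moreover have "?N \<subseteq> Idl\<^bsub>?T\<^esub> G"
  proof -
    have GT: "G \<subseteq> carrier ?T" using H by (auto simp: G_def)
    have "J \<subseteq> Idl\<^bsub>?T\<^esub> G" if J: "graded_hopf_ideal n \<xi> J" for J
    proof -
      obtain G' where G': "G' \<subseteq> ?H" "J = Idl\<^bsub>?T\<^esub> G'"
        using J unfolding graded_hopf_ideal_def by blast
      have "G' \<subseteq> J"
        unfolding G'(2) using G'(1) H by (intro T.genideal_self) (rule subset_trans)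
      then have "G' \<subseteq> G" using sub[OF J] G'(1) unfolding G_def by blast
      then show ?thesis
        unfolding G'(2) by (rule T.subset_Idl_subset[OF GT])
    qed
    then show ?thesis
      unfolding nichols_ideal_def
      by (intro pm.span_minimal subspace_ideal[OF T.genideal_ideal[OF GT]]) blast
  qed
  ultimately have gen: "?N = Idl\<^bsub>?T\<^esub> G" by blast
  let ?D = "\<lambda>I. pm.span (tens_sub I (carrier ?T) \<union> tens_sub (carrier ?T) I)"
  have D: "?D J \<subseteq> ?D ?N" if "graded_hopf_ideal n \<xi> J" for J
    using sub[OF that] unfolding tens_sub_def by (intro pm.span_mono Un_mono) blast+
  show "graded_hopf_ideal n \<xi> ?N"
    unfolding graded_hopf_ideal_def
  proof (intro conjI ballI allI impI)
    show "\<exists>G\<subseteq>?H. ?N = Idl\<^bsub>?T\<^esub> G"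
    proof (intro exI conjI)
      show "G \<subseteq> ?H" unfolding G_def by (rule Int_lower2)
    qed (rule gen)
    fix a assume "a \<in> ?N"
    then have a: "a \<in> pm.span ?U" by (simp add: nichols_ideal_def)
    have closed: "f x \<in> ?N" if "\<And>J x. graded_hopf_ideal n \<xi> J \<Longrightarrow> x \<in> J \<Longrightarrow> f x \<in> J" "x \<in> ?U" for f x
      using that sub by blast
    show "act \<xi> m a \<in> ?N" for m
      unfolding act_def
    proof (rule lin_ext_span[OF a sN], fold act_def, erule closed[rotated])
      fix J x assume "graded_hopf_ideal n \<xi> J" "x \<in> J"
      then show "act \<xi> m x \<in> J"
        unfolding graded_hopf_ideal_def by blast
    qed
    show "ccomp n h a \<in> ?N" if "h < n" for h
      unfolding ccomp_def
    proof (rule lin_ext_span[OF a sN], fold ccomp_def, erule closed[rotated])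
      fix J x assume "graded_hopf_ideal n \<xi> J" "x \<in> J"
      then show "ccomp n h x \<in> J"
        using that unfolding graded_hopf_ideal_def by blast
    qed
    show "antipode n \<xi> a \<in> ?N" 
      unfolding antipode_def
    proof (rule lin_ext_span[OF a sN], fold antipode_def, erule closed[rotated])
      fix J x assume "graded_hopf_ideal n \<xi> J" "x \<in> J"
      then show "antipode n \<xi> x \<in> J"
        unfolding graded_hopf_ideal_def by blast
    qed
    show "comult n \<xi> a \<in> ?D ?N"
      unfolding comult_def
    proof (rule lin_ext_span[OF a pm.subspace_span], fold comult_def)
      fix x assume "x \<in> ?U"
      then obtain J where J: "graded_hopf_ideal n \<xi> J" "x \<in> J" by blast
      then have "comult n \<xi> x \<in> ?D J" unfolding graded_hopf_ideal_def by blast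
      then show "comult n \<xi> x \<in> ?D ?N" using D[OF J(1)] by blast
    qed
    show "counit a = 0"
      using a
    proof (rule pm.span_induct)
      show "pm.subspace {a. counit a = (0::'k)}"
        by (simp add: pm.subspace_def counit_def lookup_add)
      fix x assume "x \<in> ?U"
      then show "counit x = 0" unfolding graded_hopf_ideal_def by blast
    qed
  qed
qed

lemma act_word: "act \<xi> m (word w) = scale (\<xi> ^ (m * length w)) (word w)"
proof -
  have "(\<Prod>_\<leftarrow>w. \<xi> ^ m) = \<xi> ^ (m * length w)"
    by (induction w) (simp_all add: power_add mult.commute)
  then show ?thesis by (simp add: act_def word_def lin_ext_single)
qed

lemma word_mult: "word u * word v = word (u @ v)"
  by (simp add: word_def mult_single plus_list_def)

lemma one_eq_word: "1 = word []"
  by (simp add: word_def zero_list_def flip: single_one)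

lemma tens_word: "tens (word u) (word v) = Poly_Mapping.single (u, v) 1"
  by (simp add: tens_def word_def lin_ext_single)

lemma tens_scale_left: "tens (scale c a) b = scale c (tens a b)"
  by (simp add: tens_def lin_ext_scale)

lemma braiding_word:
  "braiding n \<xi> (tens (word u) (word v)) = scale (\<xi> ^ (cdeg n u * length v)) (tens (word v) (word u))"
  by (simp add: braiding_def tens_word lin_ext_single act_word tens_scale_left)

lemma bmult_word:
  "bmult n \<xi> (tens (word u) (word v)) (tens (word u') (word v')) =
     scale (\<xi> ^ (cdeg n v * length u')) (tens (word (u @ u')) (word (v @ v')))"
  using braiding_word[of n \<xi> v u']
  by (simp add: bmult_def tens_word lin_ext_single lin_ext_scale word_mult)

lemma lin_ext_sum: "lin_ext f (\<Sum>i\<in>I. a i) = (\<Sum>i\<in>I. lin_ext f (a i))"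
  by (induction I rule: infinite_finite_induct) (simp_all add: lin_ext_zero lin_ext_add)

lemma lin_ext_lin_ext: "lin_ext f (lin_ext g a) = lin_ext (\<lambda>w. lin_ext f (g w)) a"
  by (simp add: lin_ext_def[of g] lin_ext_def[of "\<lambda>w. lin_ext f (g w)"] lin_ext_sum lin_ext_scale)

lemma tens_uminus_left: "tens (- a) b = - tens a b"
  by (simp add: tens_def lin_ext_uminus)

lemma tens_scale_right: "tens (word u) (scale c b) = scale c (tens (word u) b)"
  by (simp add: tens_def lin_ext_scale lin_ext_single word_def)

lemma antipode_word_Cons:
  "antipode_word n \<xi> (i # w) =
     scale (- (\<xi> ^ (cdeg n [i] * length w))) (antipode_word n \<xi> w * word [i])"
proof -
  have rev: "\<exists>c. antipode_word n \<xi> w = scale c (word (rev w))" for w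
  proof (induction w)
    case Nil
    show ?case by (rule exI[of _ 1]) (simp add: one_eq_word)
  next
    case (Cons i w)
    then obtain c where "antipode_word n \<xi> w = scale c (word (rev w))" by blast
    then have "antipode_word n \<xi> (i # w) = 
        scale (- c * \<xi> ^ (cdeg n [i] * length w)) (word (rev (i # w)))"
      by (simp add: tens_uminus_left tens_scale_right braiding_def mult_map_def lin_ext_uminus
          lin_ext_scale tens_word lin_ext_single act_word tens_scale_left word_mult)
    then show ?case by blast
  qed
  then obtain c where "antipode_word n \<xi> w = scale c (word (rev w))" by blast
  then show ?thesis
    by (simp add: tens_uminus_left tens_scale_right braiding_def mult_map_def lin_ext_uminus
        lin_ext_scale tens_word lin_ext_single act_word tens_scale_left word_mult scale_mult)
qed

lemma lin_ext_add_fun: "lin_ext f a + lin_ext g a = lin_ext (\<lambda>w. f w + g w) a"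
  by (simp add: lin_ext_def pm.scale_right_distrib sum.distrib)

lemma bmult_word_left:
  "bmult n \<xi> (tens (word u) (word v)) y =
     lin_ext (\<lambda>(u', v'). scale (\<xi> ^ (cdeg n v * length u'))
       (tens (word (u @ u')) (word (v @ v')))) y"
proof -
  have "y = lin_ext (\<lambda>(u', v'). tens (word u') (word v')) y"
    by (rule poly_mapping_eqI) (simp add: lin_ext_def tens_word split_def lookup_sum
        lookup_single when_def in_keys_iff if_distrib[of "(*) _"] cong: if_cong)
  then have "bmult n \<xi> (tens (word u) (word v)) y =
      bmult n \<xi> (tens (word u) (word v)) (lin_ext (\<lambda>(u', v'). tens (word u') (word v')) y)"
    by simp
  also have "\<dots> = lin_ext (\<lambda>(u', v'). bmult n \<xi> (tens (word u) (word v)) (tens (word u') (word v'))) y"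
    by (simp add: bmult_def tens_word lin_ext_single lin_ext_lin_ext split_def)
  finally show ?thesis by (simp add: bmult_word)
qed

lemma comult_word_Cons:
  "comult_word n \<xi> (i # w) = lin_ext (\<lambda>(u, v). tens (word (i # u)) (word v) +
     scale (\<xi> ^ (cdeg n [i] * length u)) (tens (word u) (word (i # v)))) (comult_word n \<xi> w)"
proof -
  have "bmult n \<xi> (x + y) z = bmult n \<xi> x z + bmult n \<xi> y z" for x y z
    by (simp add: bmult_def lin_ext_add)
  then show ?thesis
    by (simp add: one_eq_word bmult_word_left lin_ext_add_fun split_def)
       (simp add: cdeg_def)
qed

lemma comult_word_keys:
  fixes \<xi> :: "'k::field"
  shows "(u, v) \<in> Poly_Mapping.keys (comult_word n \<xi> w) \<Longrightarrow> length u + length v = length w"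
proof (induction w arbitrary: u v)
  case Nil
  then show ?case by (simp add: one_eq_word tens_word split: if_splits)
next
  case (Cons i w)
  let ?S = "{x :: nat list \<times> nat list \<Rightarrow>\<^sub>0 'k. Poly_Mapping.keys x \<subseteq> {(u, v). length u + length v = length (i # w)}}"
  have S: "pm.subspace ?S"
    by (rule subspace_keys)
  have "comult_word n \<xi> (i # w) \<in> ?S"
    unfolding comult_word_Cons lin_ext_def
  proof (rule pm.subspace_sum[OF S], rule pm.subspace_scale[OF S])
    fix p assume p: "p \<in> Poly_Mapping.keys (comult_word n \<xi> w)"
    obtain u v where uv: "p = (u, v)" by (cases p)
    then have "length u + length v = length w" using p Cons.IH by blast
    then have "tens (word (i # u)) (word v) \<in> ?S" "tens (word u) (word (i # v)) \<in> ?S"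
      by (auto simp: tens_word)
    then show "(case p of (u, v) \<Rightarrow> tens (word (i # u)) (word v) +
        scale (\<xi> ^ (cdeg n [i] * length u)) (tens (word u) (word (i # v)))) \<in> ?S"
      unfolding uv prod.case by (intro pm.subspace_add[OF S] pm.subspace_scale[OF S])
  qed
  then show ?case using Cons.prems by blast
qed

lemma lin_ext_cong:
  "(\<And>w. w \<in> Poly_Mapping.keys a \<Longrightarrow> f w = g w) \<Longrightarrow> lin_ext f a = lin_ext g a"
  unfolding lin_ext_def by (intro sum.cong) auto

lemma lin_ext_mult_fun:
  "lin_ext (\<lambda>p. x * g p) a = x * lin_ext g a"
  "lin_ext (\<lambda>p. scale c (g p * x)) a = scale c (lin_ext g a * x)"
  for x :: "nat list \<Rightarrow>\<^sub>0 'k::field"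
  by (simp_all add: lin_ext_def sum_distrib_left sum_distrib_right scale_mult pm.scale_sum_right
      mult.commute[of c])

text \<open>The next two lemmas confirm that \<open>antipode\<close>, defined through \<open>S m = m \<Psi> (S \<otimes> S)\<close>, is
  the convolution inverse of the identity.\<close>

lemma antipode_left:
  "lin_ext (\<lambda>(u, v). antipode_word n \<xi> u * word v) (comult_word n \<xi> w) = scale (counit (word w)) 1"
proof (cases w)
  case Nil
  then show ?thesis
    by (simp add: one_eq_word tens_word lin_ext_single word_mult)
       (simp add: counit_def word_def)
next
  case (Cons i w')
  have "lin_ext (\<lambda>(u, v). antipode_word n \<xi> u * word v) (comult_word n \<xi> w) =
      lin_ext (\<lambda>(u, v). 0) (comult_word n \<xi> w')"
    unfolding Cons comult_word_Cons lin_ext_lin_ext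
    by (rule lin_ext_cong)
      (auto simp: lin_ext_add lin_ext_scale tens_word lin_ext_single antipode_word_Cons scale_mult
          mult.assoc word_mult simp del: antipode_word.simps)
  also have "\<dots> = 0" by (simp add: lin_ext_def split_def)
  finally show ?thesis by (simp add: Cons counit_def word_def lookup_single)
qed

lemma antipode_right:
  "lin_ext (\<lambda>(u, v). word u * antipode_word n \<xi> v) (comult_word n \<xi> w) = scale (counit (word w)) 1"
proof (induction w)
  case Nil
  then show ?case
    by (simp add: one_eq_word tens_word lin_ext_single word_mult)
       (simp add: counit_def word_def)
next
  case (Cons i w)
  let ?c = "\<xi> ^ (cdeg n [i] * length w)"
  let ?G = "\<lambda>(u, v). word u * antipode_word n \<xi> v"
  have "lin_ext ?G (comult_word n \<xi> (i # w)) =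
      lin_ext (\<lambda>p. word [i] * ?G p + scale (- ?c) (?G p * word [i])) (comult_word n \<xi> w)"
    unfolding comult_word_Cons lin_ext_lin_ext
  proof (rule lin_ext_cong, clarify)
    fix u v assume "(u, v) \<in> Poly_Mapping.keys (comult_word n \<xi> w)"
    then have "length w = length u + length v" by (metis comult_word_keys)
    then show "lin_ext ?G (tens (word (i # u)) (word v) +
        scale (\<xi> ^ (cdeg n [i] * length u)) (tens (word u) (word (i # v)))) =
      word [i] * (word u * antipode_word n \<xi> v) +
        scale (- ?c) (word u * antipode_word n \<xi> v * word [i])"
      by (simp add: lin_ext_add lin_ext_scale tens_word lin_ext_single antipode_word_Cons scale_mult
          mult.assoc[symmetric] word_mult power_add distrib_left del: antipode_word.simps)
  qed
  also have "\<dots> = word [i] * lin_ext ?G (comult_word n \<xi> w) +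
      scale (- ?c) (lin_ext ?G (comult_word n \<xi> w) * word [i])"
    by (simp only: lin_ext_add_fun[symmetric] lin_ext_mult_fun)
  also have "\<dots> = scale (counit (word (i # w))) 1"
    unfolding Cons.IH by (cases w) (simp_all add: counit_def word_def lookup_single scale_mult)
  finally show ?case .
qed

text \<open>Hence \<open>ring.finite_dimension\<close> over \<open>nichols_scalars\<close> is dimension over \<open>'k\<close>.\<close>

lemma nichols_algebra_well_formed:
  fixes \<xi> :: "'k::field"
  shows "ring (nichols_algebra n \<xi>)" and "subfield (nichols_scalars n \<xi>) (nichols_algebra n \<xi>)"
proof -
  let ?T = "tensor_algebra n :: (nat list \<Rightarrow>\<^sub>0 'k) ring"
  interpret T: ring ?T by (rule ring_tensor_algebra)
  interpret I: ideal "nichols_ideal n \<xi>" ?T by (rule ideal_nichols_ideal)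
  interpret h: ring_hom_ring ?T "nichols_algebra n \<xi>" "(+>\<^bsub>?T\<^esub>) (nichols_ideal n \<xi>)"
    unfolding nichols_algebra_def by (rule I.rcos_ring_hom_ring)
  show "ring (nichols_algebra n \<xi>)" by (rule h.S.ring_axioms)
  let ?K = "range (\<lambda>c::'k. scale c (1 :: nat list \<Rightarrow>\<^sub>0 'k))"
  have KT: "?K \<subseteq> carrier ?T"
    using pm.subspace_scale[OF subspace_ta ta_one_closed] by auto
  have inv: "scale c 1 * scale (inverse c) 1 = (1 :: nat list \<Rightarrow>\<^sub>0 'k)" if "c \<noteq> 0" for c :: 'k
    using that by (simp add: scale_mult)
  have "subfield ?K ?T"
  proof (rule T.subfieldI)
    show "subcring ?K ?T"
    proof (rule T.subcringI)
      show "subring ?K ?T"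
      proof (rule T.subringI)
        show "?K \<subseteq> carrier ?T" by (rule KT)
        have "1 = scale (1::'k) (1 :: nat list \<Rightarrow>\<^sub>0 'k)" by simp
        then show "\<one>\<^bsub>?T\<^esub> \<in> ?K" unfolding ta_simps by (rule range_eqI)
      next
        fix a assume "a \<in> ?K"
        then obtain c where c: "a = scale c 1" by auto
        have "scale (- c) 1 \<in> ?K" by blast
        moreover have "\<ominus>\<^bsub>?T\<^esub> a = scale (- c) 1"
        proof (rule T.minus_equality)
          show "scale (- c) 1 \<oplus>\<^bsub>?T\<^esub> a = \<zero>\<^bsub>?T\<^esub>" by (simp add: c ta_simps(2-))
          show "a \<in> carrier ?T" "scale (- c) 1 \<in> carrier ?T" using KT unfolding c by blast+
        qed
        ultimately show "\<ominus>\<^bsub>?T\<^esub> a \<in> ?K" by simp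
      next
        fix a b assume "a \<in> ?K" "b \<in> ?K"
        then obtain c d where cd: "a = scale c 1" "b = scale d 1" by auto
        have "scale (c * d) 1 \<in> ?K" "scale (c + d) 1 \<in> ?K" by blast+
        then show "a \<otimes>\<^bsub>?T\<^esub> b \<in> ?K" "a \<oplus>\<^bsub>?T\<^esub> b \<in> ?K"
          by (simp_all add: cd ta_simps(2-) scale_mult pm.scale_left_distrib mult.commute)
      qed
    next
      fix a b assume "a \<in> ?K" "b \<in> ?K"
      then obtain c d where cd: "a = scale c 1" "b = scale d 1" by auto
      then show "a \<otimes>\<^bsub>?T\<^esub> b = b \<otimes>\<^bsub>?T\<^esub> a"
        by (simp add: ta_simps(2-) scale_mult mult.commute)
    qed
    show "Units (?T\<lparr>carrier := ?K\<rparr>) = ?K - {\<zero>\<^bsub>?T\<^esub>}"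
    proof (intro equalityI subsetI)
      fix a assume "a \<in> ?K - {\<zero>\<^bsub>?T\<^esub>}"
      then obtain c where c: "a = scale c 1" "c \<noteq> 0" by (auto simp: ta_simps(2-))
      show "a \<in> Units (?T\<lparr>carrier := ?K\<rparr>)"
        unfolding Units_def using c inv[of c] inv[of "inverse c"]
        by (auto simp: ta_simps(2-) intro!: bexI[of _ "scale (inverse c) 1"])
    qed (auto simp: Units_def ta_simps(2-))
  qed
  moreover have "\<one>\<^bsub>nichols_algebra n \<xi>\<^esub> \<noteq> \<zero>\<^bsub>nichols_algebra n \<xi>\<^esub>"
  proof
    assume "\<one>\<^bsub>nichols_algebra n \<xi>\<^esub> = \<zero>\<^bsub>nichols_algebra n \<xi>\<^esub>"
    then have "nichols_ideal n \<xi> +>\<^bsub>?T\<^esub> \<one>\<^bsub>?T\<^esub> = nichols_ideal n \<xi>"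
      unfolding nichols_algebra_def FactRing_def by simp
    then have "\<one>\<^bsub>?T\<^esub> \<in> nichols_ideal n \<xi>"
      using I.a_rcos_self[OF T.one_closed] by metis
    then have "counit \<one>\<^bsub>?T\<^esub> = 0"
      using nichols_ideal_greatest(1)[of n \<xi>] unfolding graded_hopf_ideal_def by blast
    then show False by (simp add: ta_simps(3) counit_def one_eq_word word_def)
  qed
  ultimately have "subfield ((+>\<^bsub>?T\<^esub>) (nichols_ideal n \<xi>) ` ?K) (nichols_algebra n \<xi>)"
    by (rule h.img_is_subfield(2))
  then show "subfield (nichols_scalars n \<xi>) (nichols_algebra n \<xi>)"
    unfolding nichols_scalars_def image_image .
qed

end

theory Submission
  imports Defs "HOL-Library.Multiset"
begin

text \<open>Let \<open>\<partial>\<^sub>j\<close> be the skew derivation of the tensor algebra that extracts the part \<open>\<dots> \<otimes> s\<^sub>j\<close> of the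
  coproduct.  The proof has three parts.

  \<^bold>\<open>The Nichols ideal is the radical of the skew derivations.\<close>  An element lies in the Nichols
  ideal if and only if all iterated derivations \<open>\<partial>\<^bsub>j\<^sub>1\<^esub> \<dots> \<partial>\<^bsub>j\<^sub>r\<^esub>\<close> of it have constant term zero
  (\<open>nichols_ideal_eq_deriv_radical\<close>).  Every graded Hopf ideal \<open>I\<close> is stable under \<open>\<partial>\<^sub>j\<close>, because
  \<open>\<Delta> I\<close> lies in \<open>I \<otimes> T + T \<otimes> I\<close> and \<open>I\<close> has no terms of degree one, so \<open>I\<close> is inside the radical.
  Conversely the radical is itself a graded Hopf ideal: it is an ideal by the twisted Leibniz rule,
  it is stable under the antipode \<open>S\<close> since \<open>\<partial>\<^sub>j S = - S \<partial>\<^sub>j'\<close> for a left-handed version \<open>\<partial>\<^sub>j'\<close> of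
  \<open>\<partial>\<^sub>j\<close>, and it is a coideal since by coassociativity the functionals that define it, applied to the
  right tensor factor of \<open>\<Delta> a\<close>, again produce elements of the radical.

  \<^bold>\<open>Infinite dimension for \<open>n \<ge> 5\<close>.\<close>  The letters \<open>1, 2, n - 1, n - 2\<close> are then distinct, and their
  sum is \<open>0\<close> modulo \<open>n\<close>, so that the iterated braided commutator
  \<open>z = ad s\<^sub>1 (ad s\<^sub>2 (ad s\<^bsub>n-1\<^esub> s\<^bsub>n-2\<^esub>))\<close> has self-braiding \<open>1\<close>.  All \<open>\<partial>\<^sub>j\<close> except
  \<open>\<partial>\<^bsub>n-2\<^esub>\<close> kill \<open>z\<close>.  Hence the composite \<open>D\<close> of the four derivations satisfies
  \<open>D (z\<^sup>k) = k c z\<^bsup>k-1\<^esup>\<close>, with the constant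
  \<open>c = (1 - \<xi>\<^bsup>n-3\<^esup>) (1 - \<xi>) (1 - \<xi>\<^sup>2) \<noteq> 0\<close> (\<open>iter_deriv_power\<close>, \<open>iter_deriv_iterated_ad\<close>).
  In characteristic zero \<open>D\<^sup>k (z\<^sup>k) = k! c\<^sup>k\<close> does not vanish while \<open>D\<^sup>k\<close> kills the lower powers, so the
  powers of \<open>z\<close> are linearly independent in the Nichols algebra.

  \<^bold>\<open>Finite dimension for \<open>n \<le> 4\<close>.\<close>  A straightening argument in the style of Poincare, Birkhoff and
  Witt (\<open>finite_spanning_set_of_ordered_monomials\<close>) reduces the claim to finding nilpotent generators that can
  be reordered modulo the radical.  For \<open>n = 2\<close> the generator is \<open>s\<^sub>1\<close>, and for \<open>n = 3\<close> the two letters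
  commute up to a scalar.  For \<open>n = 4\<close> the braiding is of super type \<open>A\<^sub>3\<close>, and the generators are root vectors
  for its six positive roots: \<open>s\<^sub>1\<close>, \<open>s\<^sub>2\<close>, \<open>s\<^sub>3\<close>, \<open>ad s\<^sub>1 s\<^sub>2\<close>, \<open>ad s\<^sub>3 s\<^sub>2\<close> and \<open>ad s\<^sub>1 (ad s\<^sub>3 s\<^sub>2)\<close>.
  A few relations among them follow from the derivation criterion, and all others are
  consequences of these in the free algebra.\<close>

section \<open>Linear maps on words\<close>

lemma word_induct [case_names word add scale]:
  assumes "\<And>w. P (word w)" "\<And>a b. P a \<Longrightarrow> P b \<Longrightarrow> P (a + b)" "\<And>c a. P a \<Longrightarrow> P (scale c a)"
  shows "P a"
proof (induction a rule: update_induct)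
  case const
  have "(0 :: nat list \<Rightarrow>\<^sub>0 'a) = scale 0 (word [])" by simp
  then show ?case using assms(1,3) by metis
next
  case (update f k v)
  have "Poly_Mapping.update k v f = f + scale v (word k)"
    using update(1)
    by (intro poly_mapping_eqI)
      (auto simp: lookup_update lookup_add word_def lookup_single when_def in_keys_iff)
  then show ?case using assms update(3) by metis
qed

lemma lin_ext_diff: "lin_ext f (a - b) = lin_ext f a - lin_ext f b"
  using lin_ext_add[of f a "- b"] by (simp add: lin_ext_uminus)

lemma lin_ext_word: "lin_ext f (word w) = f w"
  by (simp add: word_def lin_ext_single)

lemma tens_add_left: "tens (a + b) c = tens a c + tens b c"
  by (simp add: tens_def lin_ext_add)

lemma tens_add_right: "tens a (b + c) = tens a b + tens a c"
  by (simp add: tens_def lin_ext_add lin_ext_add_fun)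

lemma tens_scale_right': "tens a (scale c b) = scale c (tens a b)"
proof -
  have "lin_ext (\<lambda>u. lin_ext (f u) (scale c b)) a = scale c (lin_ext (\<lambda>u. lin_ext (f u) b) a)" for f
    unfolding lin_ext_scale by (simp add: lin_ext_def pm.scale_sum_right mult.left_commute)
  then show ?thesis by (simp add: tens_def)
qed

lemma tens_zero: "tens 0 a = 0" "tens a 0 = 0"
  by (simp_all add: tens_def lin_ext_def)

lemma tens_sum_left: "tens (\<Sum>v\<in>S. f v) b = (\<Sum>v\<in>S. tens (f v) b)"
  by (induction S rule: infinite_finite_induct) (simp_all add: tens_zero tens_add_left)

lemma lookup_word: "Poly_Mapping.lookup (word w) v = (if w = v then 1 else 0)"
  by (simp add: word_def lookup_single when_def)

lemma counit_simps [simp]: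
  "counit (a + b) = counit a + counit b" "counit (scale c a) = c * counit a"
  "counit (word w) = (if w = [] then 1 else 0)" "counit 0 = 0" "counit (- a) = - counit a"
  "counit (a - b) = counit a - counit b"
  by (simp_all add: counit_def lookup_add lookup_minus lookup_word)

lemma act_add: "act \<xi> m (a + b) = act \<xi> m a + act \<xi> m b"
  and act_scale: "act \<xi> m (scale c a) = scale c (act \<xi> m a)"
  and act_zero: "act \<xi> m 0 = 0"
  and act_diff: "act \<xi> m (a - b) = act \<xi> m a - act \<xi> m b"
  by (simp_all add: act_def lin_ext_add lin_ext_scale lin_ext_zero lin_ext_diff)

lemma act_mult: "act \<xi> m (a * b) = act \<xi> m a * act \<xi> m b"
proof (induction a rule: word_induct)
  case (word u)
  show ?case
    by (induction b rule: word_induct)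
      (simp_all add: act_word act_add act_scale word_mult scale_mult power_add distrib_left mult.commute)
qed (simp_all add: act_add act_scale distrib_right scale_mult)

lemma act_one: "act \<xi> m 1 = 1"
  by (simp add: one_eq_word act_word)

section \<open>Skew derivations\<close>

text \<open>The part of the coproduct of a word with right factor \<open>s\<^sub>j\<close>: every occurrence of \<open>s\<^sub>j\<close> is moved to the
  right end of the word, and the braiding contributes \<open>\<xi>\<^sup>j\<close> for each letter that it passes.\<close>

primrec deriv_word :: "'k::field \<Rightarrow> nat \<Rightarrow> nat list \<Rightarrow> (nat list \<Rightarrow>\<^sub>0 'k)" where
  "deriv_word \<xi> j [] = 0"
| "deriv_word \<xi> j (i # w) =
     word [i] * deriv_word \<xi> j w + (if i = j then act \<xi> j (word w) else 0)"

definition skew_deriv :: "'k::field \<Rightarrow> nat \<Rightarrow> (nat list \<Rightarrow>\<^sub>0 'k) \<Rightarrow> (nat list \<Rightarrow>\<^sub>0 'k)" where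
  "skew_deriv \<xi> j = lin_ext (deriv_word \<xi> j)"

primrec iter_deriv :: "'k::field \<Rightarrow> nat list \<Rightarrow> (nat list \<Rightarrow>\<^sub>0 'k) \<Rightarrow> (nat list \<Rightarrow>\<^sub>0 'k)" where
  "iter_deriv \<xi> [] a = a"
| "iter_deriv \<xi> (j # w) a = iter_deriv \<xi> w (skew_deriv \<xi> j a)"

definition deriv_radical :: "nat \<Rightarrow> 'k::field \<Rightarrow> (nat list \<Rightarrow>\<^sub>0 'k) set" where
  "deriv_radical n \<xi> = {a \<in> carrier (tensor_algebra n). \<forall>w. counit (iter_deriv \<xi> w a) = 0}"

lemma skew_deriv_linear:
  "skew_deriv \<xi> j (a + b) = skew_deriv \<xi> j a + skew_deriv \<xi> j b"
  "skew_deriv \<xi> j (scale c a) = scale c (skew_deriv \<xi> j a)"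
  "skew_deriv \<xi> j 0 = 0"
  "skew_deriv \<xi> j (- a) = - skew_deriv \<xi> j a"
  "skew_deriv \<xi> j (a - b) = skew_deriv \<xi> j a - skew_deriv \<xi> j b"
  by (simp_all add: skew_deriv_def lin_ext_add lin_ext_scale lin_ext_zero lin_ext_uminus lin_ext_diff)

lemma iter_deriv_linear:
  "iter_deriv \<xi> w (a + b) = iter_deriv \<xi> w a + iter_deriv \<xi> w b"
  "iter_deriv \<xi> w (scale c a) = scale c (iter_deriv \<xi> w a)"
  "iter_deriv \<xi> w 0 = 0"
  "iter_deriv \<xi> w (- a) = - iter_deriv \<xi> w a"
  by (induction w arbitrary: a b) (simp_all add: skew_deriv_linear)

lemma skew_deriv_word: "skew_deriv \<xi> j (word w) = deriv_word \<xi> j w"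
  by (simp add: skew_deriv_def lin_ext_word)

lemma skew_deriv_letter: "skew_deriv \<xi> j (word [i]) = (if i = j then 1 else 0)"
  by (simp add: skew_deriv_word act_word one_eq_word)

lemma skew_deriv_one: "skew_deriv \<xi> j 1 = 0"
  by (simp add: one_eq_word skew_deriv_word)

text \<open>The Leibniz rule is twisted on one side only, because extracting \<open>s\<^sub>j\<close> to the right from the left factor
  moves it past the right factor, and \<open>\<Psi> (s\<^sub>j \<otimes> b) = (g\<^sup>j \<cdot> b) \<otimes> s\<^sub>j\<close>.\<close>

lemma skew_deriv_mult:
  "skew_deriv \<xi> j (a * b) = a * skew_deriv \<xi> j b + skew_deriv \<xi> j a * act \<xi> j b"
proof (induction b rule: word_induct)
  case (word v)
  show ?case
  proof (induction a rule: word_induct)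
    case (word u)
    show ?case
    proof (induction u)
      case Nil
      show ?case by (simp add: skew_deriv_one flip: one_eq_word)
    next
      case (Cons i u)
      have "word (i # u) = word [i] * word u" by (simp add: word_mult)
      moreover have "word (i # u) * a = word [i] * (word u * a)" for a :: "nat list \<Rightarrow>\<^sub>0 'a"
        by (simp add: word_mult flip: mult.assoc)
      moreover have "act \<xi> j (word (u @ v)) = act \<xi> j (word u) * act \<xi> j (word v)"
        by (simp flip: act_mult word_mult)
      ultimately show ?case
        using Cons by (simp add: skew_deriv_word word_mult distrib_left distrib_right add_ac mult.assoc)
    qed
  qed (simp_all add: skew_deriv_linear algebra_simps scale_mult pm.scale_right_distrib)
qed (simp_all add: skew_deriv_linear act_add act_scale algebra_simps scale_mult pm.scale_right_distrib)

lemma skew_deriv_act: "skew_deriv \<xi> j (act \<xi> m a) = scale (\<xi> ^ m) (act \<xi> m (skew_deriv \<xi> j a))"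
proof (induction a rule: word_induct)
  case (word w)
  show ?case
  proof (induction w)
    case Nil
    show ?case by (simp add: act_word skew_deriv_linear skew_deriv_word act_zero)
  next
    case (Cons i w)
    have *: "word (i # w) = word [i] * word w" by (simp add: word_mult)
    show ?case
      unfolding * act_mult skew_deriv_mult Cons
      by (simp add: skew_deriv_letter act_word skew_deriv_linear scale_mult act_add act_scale act_mult
          mult.commute pm.scale_right_distrib act_zero act_one)
  qed
qed (simp_all add: skew_deriv_linear act_add act_scale pm.scale_right_distrib mult.commute)

lemma keys_deriv_word: "v \<in> Poly_Mapping.keys (deriv_word \<xi> j w) \<Longrightarrow> add_mset j (mset v) = mset w"
proof (induction w arbitrary: v)
  case (Cons i w)
  have "v \<in> Poly_Mapping.keys (word [i] * deriv_word \<xi> j w) \<or>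
    (i = j \<and> v \<in> Poly_Mapping.keys (act \<xi> j (word w)))"
    using Cons.prems Poly_Mapping.keys_add by (fastforce split: if_splits)
  then show ?case
  proof
    assume "v \<in> Poly_Mapping.keys (word [i] * deriv_word \<xi> j w)"
    then obtain v' where "v = i # v'" "v' \<in> Poly_Mapping.keys (deriv_word \<xi> j w)"
      using keys_mult[of "word [i]" "deriv_word \<xi> j w"] by (auto simp: plus_list_def word_def)
    with Cons.IH show ?case by (metis add_mset_commute mset.simps(2))
  next
    assume "i = j \<and> v \<in> Poly_Mapping.keys (act \<xi> j (word w))"
    then show ?case by (auto simp: act_word in_keys_iff lookup_word split: if_splits)
  qed
qed simp


section \<open>The radical of the skew derivations\<close>

lemma lin_ext_word_self: "lin_ext word a = a"
  by (induction a rule: word_induct) (simp_all add: lin_ext_word lin_ext_add lin_ext_scale)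

lemma counit_skew_deriv: "counit (skew_deriv \<xi> j a) = Poly_Mapping.lookup a [j]"
proof (induction a rule: word_induct)
  case (word w)
  show ?case
  proof (cases w)
    case Nil
    then show ?thesis by (simp add: skew_deriv_word lookup_word)
  next
    case (Cons i v)
    have "[] \<notin> Poly_Mapping.keys (word [i] * deriv_word \<xi> j v)"
      using keys_mult[of "word [i]" "deriv_word \<xi> j v"] by (auto simp: plus_list_def word_def)
    then have "counit (word [i] * deriv_word \<xi> j v) = 0"
      by (simp add: counit_def in_keys_iff)
    then show ?thesis
      by (simp add: Cons skew_deriv_word act_word lookup_word)
  qed
qed (simp_all add: skew_deriv_linear lookup_add)

lemma counit_iter_deriv_expand:
  "counit (iter_deriv \<xi> w a) =
     (\<Sum>v\<in>Poly_Mapping.keys a. Poly_Mapping.lookup a v * counit (iter_deriv \<xi> w (word v)))"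
proof -
  have "counit (iter_deriv \<xi> w (\<Sum>v\<in>S. scale (f v) (word v))) =
      (\<Sum>v\<in>S. f v * counit (iter_deriv \<xi> w (word v)))" if "finite S" for S f
    using that by (induction S rule: finite_induct) (simp_all add: iter_deriv_linear)
  from this[OF finite_keys, of "Poly_Mapping.lookup a" a] show ?thesis
    unfolding lin_ext_def[of word a, symmetric] lin_ext_word_self .
qed

text \<open>A derivation deletes a letter, so an iterated derivation leaves a constant only if it deletes exactly the
  letters of the word.  Therefore the radical is graded by the multiset of letters, and in particular
  by length and by the degree in the cyclic group.\<close>

lemma counit_iter_deriv_word:
  "mset v \<noteq> mset w \<Longrightarrow> counit (iter_deriv \<xi> w (word v)) = 0"
proof (induction w arbitrary: v)
  case (Cons j w)
  have "mset u \<noteq> mset w" if "u \<in> Poly_Mapping.keys (deriv_word \<xi> j v)" for u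
    using Cons.prems keys_deriv_word[OF that] by auto
  then show ?case
    by (simp add: skew_deriv_word counit_iter_deriv_expand[of \<xi> w "deriv_word \<xi> j v"] Cons.IH)
qed simp

text \<open>The weight \<open>c\<close> covers the projection to a homogeneous part, with \<open>c\<close> an indicator function, as well
  as the group action, with \<open>c\<close> a power of \<open>\<xi>\<close>.\<close>

lemma counit_iter_deriv_part:
  assumes "\<And>u v. mset u = mset v \<Longrightarrow> c u = c v"
  shows "counit (iter_deriv \<xi> w (lin_ext (\<lambda>v. scale (c v) (word v)) a)) = c w * counit (iter_deriv \<xi> w a)"
proof (induction a rule: word_induct)
  case (word v)
  then show ?case
    using assms[of v w] counit_iter_deriv_word[of v w] by (auto simp: lin_ext_word iter_deriv_linear)
qed (simp_all add: lin_ext_add lin_ext_scale iter_deriv_linear algebra_simps)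

lemma lookup_lin_ext_scale:
  "Poly_Mapping.lookup (lin_ext (\<lambda>v. scale (c v) (word v)) a) v = c v * Poly_Mapping.lookup a v"
  by (induction a rule: word_induct)
    (simp_all add: lin_ext_word lin_ext_add lin_ext_scale lookup_word lookup_add algebra_simps)

lemma keys_lin_ext_scale:
  "Poly_Mapping.keys (lin_ext (\<lambda>v. scale (c v) (word v)) a) = {v \<in> Poly_Mapping.keys a. c v \<noteq> 0}"
  by (auto simp: in_keys_iff lookup_lin_ext_scale)

lemma part_in_deriv_radical:
  assumes "\<And>u v. mset u = mset v \<Longrightarrow> c u = c v" "a \<in> deriv_radical n \<xi>"
  shows "lin_ext (\<lambda>v. scale (c v) (word v)) a \<in> deriv_radical n \<xi>"
  using assms(2) counit_iter_deriv_part[OF assms(1)]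
  by (auto simp: deriv_radical_def ta_simps keys_lin_ext_scale)

lemma act_in_deriv_radical:
  assumes "a \<in> deriv_radical n \<xi>"
  shows "act \<xi> m a \<in> deriv_radical n \<xi>"
proof -
  have "act \<xi> m a = lin_ext (\<lambda>v. scale (\<xi> ^ (m * length v)) (word v)) a"
    by (induction a rule: word_induct) (simp_all add: act_word act_add act_scale lin_ext_word lin_ext_add lin_ext_scale)
  then show ?thesis
    using part_in_deriv_radical[OF _ assms, of "\<lambda>v. \<xi> ^ (m * length v)"]
    by (metis mset_eq_length)
qed

lemma keys_skew_deriv:
  "v \<in> Poly_Mapping.keys (skew_deriv \<xi> j a) \<Longrightarrow> \<exists>w \<in> Poly_Mapping.keys a. add_mset j (mset v) = mset w"
proof -
  assume v: "v \<in> Poly_Mapping.keys (skew_deriv \<xi> j a)"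
  have "Poly_Mapping.lookup (skew_deriv \<xi> j a) v =
      (\<Sum>w\<in>Poly_Mapping.keys a. Poly_Mapping.lookup a w * Poly_Mapping.lookup (deriv_word \<xi> j w) v)"
    by (simp add: skew_deriv_def lin_ext_def lookup_sum)
  then obtain w where "w \<in> Poly_Mapping.keys a" "Poly_Mapping.lookup (deriv_word \<xi> j w) v \<noteq> 0"
    using v by (metis (no_types, lifting) in_keys_iff mult_eq_0_iff sum.not_neutral_contains_not_neutral)
  then show ?thesis using keys_deriv_word by (metis in_keys_iff)
qed

lemma skew_deriv_closed:
  assumes "a \<in> carrier (tensor_algebra n)"
  shows "skew_deriv \<xi> j a \<in> carrier (tensor_algebra n)"
  unfolding ta_simps
proof safe
  fix v i assume "v \<in> Poly_Mapping.keys (skew_deriv \<xi> j a)" "i \<in> set v"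
  then obtain w where w: "w \<in> Poly_Mapping.keys a" "add_mset j (mset v) = mset w"
    using keys_skew_deriv by blast
  then have "i \<in> set w"
    using \<open>i \<in> set v\<close> mset_eq_setD[of "j # v" w] by auto
  then show "i \<in> {1..<n}" using w(1) assms unfolding ta_simps by blast
qed

lemma skew_deriv_in_deriv_radical:
  "a \<in> deriv_radical n \<xi> \<Longrightarrow> skew_deriv \<xi> j a \<in> deriv_radical n \<xi>"
  unfolding deriv_radical_def
proof safe
  fix w assume "\<forall>w. counit (iter_deriv \<xi> w a) = 0"
  then have "counit (iter_deriv \<xi> (j # w) a) = 0" by blast
  then show "counit (iter_deriv \<xi> w (skew_deriv \<xi> j a)) = 0" by simp
qed (rule skew_deriv_closed)

text \<open>Membership of an explicit element can be decided recursively in the degree; the basic relations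
  of the Nichols algebra are established in this way.\<close>

lemma deriv_radicalI:
  assumes "a \<in> carrier (tensor_algebra n)" "counit a = 0" "\<And>j. skew_deriv \<xi> j a \<in> deriv_radical n \<xi>"
  shows "a \<in> deriv_radical n \<xi>"
proof -
  have "counit (iter_deriv \<xi> w a) = 0" for w
    using assms(2,3) by (cases w) (auto simp: deriv_radical_def)
  then show ?thesis using assms(1) by (simp add: deriv_radical_def)
qed

lemma subspace_deriv_radical: "pm.subspace (deriv_radical n \<xi>)"
  using subspace_ta[of n] by (auto simp: pm.subspace_def deriv_radical_def iter_deriv_linear)

text \<open>A derivation of \<open>s\<^sub>i a\<close> or \<open>a s\<^sub>i\<close> is a combination of \<open>s\<^sub>i (\<partial>\<^sub>j a)\<close>, respectively \<open>(\<partial>\<^sub>j a) s\<^sub>i\<close>, and a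
  twist of \<open>a\<close>, all of which are covered by induction on the number of derivations.\<close>

lemma letter_mult_in_deriv_radical:
  assumes "a \<in> deriv_radical n \<xi>" "i \<in> {1..<n}"
  shows "word [i] * a \<in> deriv_radical n \<xi>" "a * word [i] \<in> deriv_radical n \<xi>"
proof -
  have letter: "word [i] \<in> carrier (tensor_algebra n)"
    using assms(2) by (simp add: ta_simps word_def)
  have "counit (iter_deriv \<xi> w (word [i] * a)) = 0 \<and> counit (iter_deriv \<xi> w (a * word [i])) = 0"
    if "a \<in> deriv_radical n \<xi>" for w a
    using that
  proof (induction w arbitrary: a)
    case Nil
    have "[] \<notin> Poly_Mapping.keys (word [i] * a)" "[] \<notin> Poly_Mapping.keys (a * word [i])"
      using keys_mult[of "word [i]" a] keys_mult[of a "word [i]"] by (auto simp: plus_list_def word_def)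
    then show ?case by (simp add: counit_def in_keys_iff)
  next
    case (Cons j w)
    have F: "counit (iter_deriv \<xi> w b) = 0" if "b \<in> deriv_radical n \<xi>" for b
      using that by (simp add: deriv_radical_def)
    show ?case
      using Cons.IH[OF skew_deriv_in_deriv_radical[OF Cons.prems, of j]]
        F[OF act_in_deriv_radical[OF Cons.prems, of j]] F[OF Cons.prems]
      by (simp add: skew_deriv_mult skew_deriv_letter act_word scale_mult iter_deriv_linear)
  qed
  then show "word [i] * a \<in> deriv_radical n \<xi>" "a * word [i] \<in> deriv_radical n \<xi>"
    using assms(1) letter by (auto simp: deriv_radical_def intro: ta_mult_closed)
qed

lemma ideal_deriv_radical: "ideal (deriv_radical n \<xi>) (tensor_algebra n)"
proof (rule ideal_subspace)
  have words: "word w * a \<in> deriv_radical n \<xi> \<and> a * word w \<in> deriv_radical n \<xi>"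
    if "a \<in> deriv_radical n \<xi>" "w \<in> lists {1..<n}" for a w
    using that(2,1)
  proof (induction w arbitrary: a)
    case Nil
    then show ?case by (simp flip: one_eq_word)
  next
    case (Cons i w)
    have "word (i # w) * a = word [i] * (word w * a)"
      by (simp add: word_mult flip: mult.assoc)
    moreover have "a * word (i # w) = a * word [i] * word w"
      by (simp add: word_mult mult.assoc)
    ultimately show ?case
      using Cons letter_mult_in_deriv_radical[of _ n \<xi> i] by simp
  qed
  fix a x :: "nat list \<Rightarrow>\<^sub>0 'a"
  assume a: "a \<in> deriv_radical n \<xi>" and x: "x \<in> carrier (tensor_algebra n)"
  have x_sum: "x = (\<Sum>w\<in>Poly_Mapping.keys x. scale (Poly_Mapping.lookup x w) (word w))"
    using lin_ext_word_self[of x] by (simp add: lin_ext_def)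
  have keys: "w \<in> lists {1..<n}" if "w \<in> Poly_Mapping.keys x" for w
    using x that unfolding ta_simps by blast
  have "(\<Sum>w\<in>Poly_Mapping.keys x. scale (Poly_Mapping.lookup x w) (word w)) * a \<in> deriv_radical n \<xi>"
    "a * (\<Sum>w\<in>Poly_Mapping.keys x. scale (Poly_Mapping.lookup x w) (word w)) \<in> deriv_radical n \<xi>"
    unfolding sum_distrib_left sum_distrib_right scale_mult
    by (auto intro!: pm.subspace_sum[OF subspace_deriv_radical]
        pm.subspace_scale[OF subspace_deriv_radical] dest!: words[OF a keys])
  then show "x * a \<in> deriv_radical n \<xi>" "a * x \<in> deriv_radical n \<xi>"
    unfolding x_sum[symmetric] .
qed (use subspace_deriv_radical in \<open>auto simp: deriv_radical_def\<close>)

section \<open>Skew derivations and the coproduct\<close>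

text \<open>The map \<open>id \<otimes> \<phi>\<close> for a linear functional \<open>\<phi>\<close>.\<close>

definition slice :: "((nat list \<Rightarrow>\<^sub>0 'k::field) \<Rightarrow> 'k) \<Rightarrow> (nat list \<times> nat list \<Rightarrow>\<^sub>0 'k) \<Rightarrow> (nat list \<Rightarrow>\<^sub>0 'k)" where
  "slice \<phi> = lin_ext (\<lambda>(u, v). scale (\<phi> (word v)) (word u))"

lemma sum_tens_slices:
  defines "U x \<equiv> fst ` Poly_Mapping.keys x" and "V x \<equiv> snd ` Poly_Mapping.keys x"
    and "d x v \<equiv> (\<Sum>u\<in>fst ` Poly_Mapping.keys x. scale (Poly_Mapping.lookup x (u, v)) (word u))"
  shows "x = (\<Sum>v\<in>V x. tens (d x v) (word v))"
    and "slice \<phi> x = (\<Sum>v\<in>V x. scale (\<phi> (word v)) (d x v))"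
proof -
  have fin: "finite (U x \<times> V x)" "Poly_Mapping.keys x \<subseteq> U x \<times> V x"
    by (auto simp: U_def V_def image_iff) (metis fst_conv, metis snd_conv)

  have ext: "lin_ext f x = (\<Sum>v\<in>V x. \<Sum>u\<in>U x. scale (Poly_Mapping.lookup x (u, v)) (f (u, v)))"
    for f :: "_ \<Rightarrow> 'b \<Rightarrow>\<^sub>0 'a"
    unfolding lin_ext_superset[OF fin] sum.cartesian_product'
    by (simp add: sum.swap[of _ "U x"])
  have "x = lin_ext (\<lambda>p. Poly_Mapping.single p 1) x"
    by (rule poly_mapping_eqI) (simp add: lin_ext_def lookup_sum
        lookup_single when_def in_keys_iff if_distrib[of "(*) _"] cong: if_cong)
  also have "\<dots> = (\<Sum>v\<in>V x. tens (d x v) (word v))"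
    unfolding ext by (simp add: d_def tens_sum_left tens_scale_left tens_word U_def)
  finally show "x = (\<Sum>v\<in>V x. tens (d x v) (word v))" .
  show "slice \<phi> x = (\<Sum>v\<in>V x. scale (\<phi> (word v)) (d x v))"
    unfolding slice_def ext by (simp add: d_def U_def pm.scale_sum_right mult.commute)
qed

lemma slice_linear:
  "slice \<phi> (x + y) = slice \<phi> x + slice \<phi> y" "slice \<phi> (scale c x) = scale c (slice \<phi> x)"
  "slice \<phi> 0 = 0"
  by (simp_all add: slice_def lin_ext_add lin_ext_scale lin_ext_zero)

lemma tens_word_induct [case_names word add scale]:
  assumes "\<And>u v. P (tens (word u) (word v))" "\<And>a b. P a \<Longrightarrow> P b \<Longrightarrow> P (a + b)"
    "\<And>c a. P a \<Longrightarrow> P (scale c a)"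
  shows "P x"
proof (induction x rule: update_induct)
  case const
  have "(0 :: nat list \<times> nat list \<Rightarrow>\<^sub>0 'a) = scale 0 (tens (word []) (word []))" by simp
  then show ?case using assms(1,3) by metis
next
  case (update f k v)
  have "Poly_Mapping.update k v f = f + scale v (tens (word (fst k)) (word (snd k)))"
    using update(1)
    by (intro poly_mapping_eqI)
      (auto simp: lookup_update lookup_add tens_word lookup_single when_def in_keys_iff)
  then show ?case using assms update(3) by metis
qed

lemma slice_tens:
  assumes "\<And>a b. \<phi> (a + b) = \<phi> a + \<phi> b" "\<And>c a. \<phi> (scale c a) = c * \<phi> a"
  shows "slice \<phi> (tens a b) = scale (\<phi> b) a"
proof (induction b rule: word_induct)
  case (word v)
  show ?case
    by (induction a rule: word_induct)
      (simp_all add: slice_linear tens_add_left tens_scale_left slice_def tens_word lin_ext_single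
        pm.scale_right_distrib mult.commute lin_ext_add lin_ext_scale)
qed (simp_all add: tens_add_right tens_scale_right' slice_linear assms pm.scale_left_distrib)

lemma comult_linear:
  "comult n \<xi> (a + b) = comult n \<xi> a + comult n \<xi> b"
  "comult n \<xi> (scale c a) = scale c (comult n \<xi> a)"
  "comult n \<xi> 0 = 0"
  "comult n \<xi> (word w) = comult_word n \<xi> w"
  by (simp_all add: comult_def lin_ext_add lin_ext_scale lin_ext_zero lin_ext_word)

text \<open>Letters are neither created nor destroyed by the coproduct, which keeps its two factors inside the
  tensor algebra of the given letters.\<close>

lemma keys_comult_word_mset:
  fixes \<xi> :: "'k::field"
  shows "(u, v) \<in> Poly_Mapping.keys (comult_word n \<xi> w) \<Longrightarrow> mset u + mset v = mset w"
proof (induction w arbitrary: u v)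
  case Nil
  then show ?case by (simp add: one_eq_word tens_word split: if_splits)
next
  case (Cons i w)
  let ?S = "{x :: nat list \<times> nat list \<Rightarrow>\<^sub>0 'k. Poly_Mapping.keys x \<subseteq> {(u, v). mset u + mset v = mset (i # w)}}"
  have S: "pm.subspace ?S"
    by (rule subspace_keys)
  have "comult_word n \<xi> (i # w) \<in> ?S"
    unfolding comult_word_Cons lin_ext_def
  proof (rule pm.subspace_sum[OF S], rule pm.subspace_scale[OF S])
    fix p assume p: "p \<in> Poly_Mapping.keys (comult_word n \<xi> w)"
    obtain u v where uv: "p = (u, v)" by (cases p)
    then have "mset u + mset v = mset w" using p Cons.IH by blast
    then have "tens (word (i # u)) (word v) \<in> ?S" "tens (word u) (word (i # v)) \<in> ?S"
      by (auto simp: tens_word)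
    then show "(case p of (u, v) \<Rightarrow> tens (word (i # u)) (word v) +
        scale (\<xi> ^ (cdeg n [i] * length u)) (tens (word u) (word (i # v)))) \<in> ?S"
      unfolding uv prod.case by (intro pm.subspace_add[OF S] pm.subspace_scale[OF S])
  qed
  then show ?case using Cons.prems by blast
qed

text \<open>The operators \<open>id \<otimes> \<partial>\<^sub>j\<close>, \<open>g\<^sup>j \<otimes> g\<^sup>j\<close> and left multiplication by \<open>\<Delta> s\<^sub>i\<close> on \<open>T(Y) \<otimes> T(Y)\<close>.\<close>

definition deriv_right :: "'k::field \<Rightarrow> nat \<Rightarrow> (nat list \<times> nat list \<Rightarrow>\<^sub>0 'k) \<Rightarrow> (nat list \<times> nat list \<Rightarrow>\<^sub>0 'k)" where
  "deriv_right \<xi> j = lin_ext (\<lambda>(u, v). tens (word u) (skew_deriv \<xi> j (word v)))"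

definition act_tens :: "'k::field \<Rightarrow> nat \<Rightarrow> (nat list \<times> nat list \<Rightarrow>\<^sub>0 'k) \<Rightarrow> (nat list \<times> nat list \<Rightarrow>\<^sub>0 'k)" where
  "act_tens \<xi> j = lin_ext (\<lambda>(u, v). tens (act \<xi> j (word u)) (act \<xi> j (word v)))"

definition letter_comult :: "'k::field \<Rightarrow> nat \<Rightarrow> (nat list \<times> nat list \<Rightarrow>\<^sub>0 'k) \<Rightarrow> (nat list \<times> nat list \<Rightarrow>\<^sub>0 'k)" where
  "letter_comult \<xi> i = lin_ext (\<lambda>(u, v). tens (word (i # u)) (word v) +
     scale (\<xi> ^ (i * length u)) (tens (word u) (word (i # v))))"

lemma letter_comult_tens:
  "letter_comult \<xi> i (tens (word u) b) = tens (word (i # u)) b + scale (\<xi> ^ (i * length u)) (tens (word u) (word [i] * b))"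
  by (induction b rule: word_induct)
    (simp_all add: letter_comult_def tens_word lin_ext_single tens_add_right lin_ext_add distrib_left
      pm.scale_right_distrib tens_scale_right' lin_ext_scale scale_mult mult.commute word_mult add_ac)

lemma deriv_right_tens:
  "deriv_right \<xi> j (tens (word p) (word q)) = tens (word p) (skew_deriv \<xi> j (word q))"
  by (simp add: deriv_right_def tens_word lin_ext_single)

lemma deriv_right_linear:
  "deriv_right \<xi> j (x + y) = deriv_right \<xi> j x + deriv_right \<xi> j y"
  "deriv_right \<xi> j (scale c x) = scale c (deriv_right \<xi> j x)"
  by (simp_all add: deriv_right_def lin_ext_add lin_ext_scale)

text \<open>The Leibniz rule for \<open>id \<otimes> \<partial>\<^sub>j\<close> on a product with \<open>\<Delta> s\<^sub>i = s\<^sub>i \<otimes> 1 + 1 \<otimes> s\<^sub>i\<close>: when \<open>i = j\<close>, the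
  braiding moves \<open>s\<^sub>i\<close> past both tensor factors, which accounts for \<open>g\<^sup>j \<otimes> g\<^sup>j\<close>.\<close>

lemma deriv_right_letter_comult:
  "deriv_right \<xi> j (letter_comult \<xi> i x) =
     letter_comult \<xi> i (deriv_right \<xi> j x) + (if i = j then act_tens \<xi> j x else 0)"
proof (induction x rule: tens_word_induct)
  case (word u v)
  have lc: "letter_comult \<xi> i (tens (word u) (word v)) =
      tens (word (i # u)) (word v) + scale (\<xi> ^ (i * length u)) (tens (word u) (word (i # v)))"
    by (simp add: letter_comult_tens word_mult)

  have iv: "word (i # v) = word [i] * word v" by (simp add: word_mult)
  show ?case
    unfolding lc
    unfolding deriv_right_linear deriv_right_tens letter_comult_tens
    unfolding iv skew_deriv_mult skew_deriv_letter
    by (simp add: tens_add_right act_tens_def tens_word[of u v] lin_ext_single act_word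
        tens_scale_left tens_scale_right' pm.scale_right_distrib tens_zero)
next
  case (add a b)
  then show ?case
    by (simp add: deriv_right_def act_tens_def letter_comult_def lin_ext_add)
next
  case (scale c a)
  then show ?case
    by (simp add: deriv_right_def act_tens_def letter_comult_def lin_ext_scale pm.scale_right_distrib)
qed

lemma act_tens_comult: "act_tens \<xi> j (comult n \<xi> a) = comult n \<xi> (act \<xi> j a)"
proof (induction a rule: word_induct)
  case (word w)
  have "act_tens \<xi> j (comult_word n \<xi> w) =
      lin_ext (\<lambda>p. scale (\<xi> ^ (j * length w)) (Poly_Mapping.single p 1)) (comult_word n \<xi> w)"
    unfolding act_tens_def
  proof (rule lin_ext_cong, clarify)
    fix u v assume "(u, v) \<in> Poly_Mapping.keys (comult_word n \<xi> w)"
    then have "length w = length u + length v" by (metis comult_word_keys)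
    then show "tens (act \<xi> j (word u)) (act \<xi> j (word v)) =
        scale (\<xi> ^ (j * length w)) (Poly_Mapping.single (u, v) 1)"
      by (simp add: act_word tens_scale_left tens_scale_right' tens_word distrib_left power_add)
  qed
  also have "\<dots> = scale (\<xi> ^ (j * length w)) (comult_word n \<xi> w)"
  proof -
    have "lin_ext (\<lambda>p. scale c (Poly_Mapping.single p 1)) x = scale c x" for c :: 'a and x :: "nat list \<times> nat list \<Rightarrow>\<^sub>0 'a"
      by (induction x rule: tens_word_induct)
        (simp_all add: tens_word lin_ext_single lin_ext_add lin_ext_scale pm.scale_right_distrib mult.commute)
    then show ?thesis .
  qed
  finally show ?case by (simp add: act_word comult_linear)
next
  case (add a b)
  then show ?case by (simp add: act_tens_def comult_linear act_add lin_ext_add)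
next
  case (scale c a)
  then show ?case by (simp add: act_tens_def comult_linear act_scale lin_ext_scale)
qed

context
  fixes n :: nat and \<xi> :: "'k::field"
  assumes root: "\<xi> ^ n = 1"
begin

lemma power_mod_root: "\<xi> ^ (i mod n * m) = \<xi> ^ (i * m)"
proof -
  have "\<xi> ^ i = \<xi> ^ (i mod n)"
    using root by (metis mult_div_mod_eq power_add power_mult power_one mult_1)
  then show ?thesis by (simp add: power_mult)
qed

lemma comult_letter_mult: "comult n \<xi> (word [i] * a) = letter_comult \<xi> i (comult n \<xi> a)"
  by (induction a rule: word_induct)
    (simp_all add: word_mult comult_linear comult_word_Cons letter_comult_def cdeg_def power_mod_root
      distrib_left lin_ext_add scale_mult lin_ext_scale del: comult_word.simps(2))

text \<open>An instance of coassociativity, and the reason why iterated derivations know the whole coproduct.\<close>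

lemma deriv_right_comult: "deriv_right \<xi> j (comult n \<xi> a) = comult n \<xi> (skew_deriv \<xi> j a)"
proof (induction a rule: word_induct)
  case (word w)
  show ?case
  proof (induction w)
    case Nil
    show ?case
      by (simp add: comult_linear skew_deriv_word one_eq_word deriv_right_def tens_word lin_ext_single tens_zero)
  next
    case (Cons i w)
    have *: "word (i # w) = word [i] * word w" by (simp add: word_mult)
    show ?case
      unfolding * comult_letter_mult deriv_right_letter_comult Cons skew_deriv_mult skew_deriv_letter
      using act_tens_comult[of \<xi> j n "word w"] by (simp add: comult_linear comult_letter_mult)
  qed
next
  case (add a b)
  then show ?case by (simp add: deriv_right_def comult_linear skew_deriv_linear lin_ext_add)
next
  case (scale c a)
  then show ?case by (simp add: deriv_right_def comult_linear skew_deriv_linear lin_ext_scale)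
qed

lemma slice_counit_comult: "slice counit (comult n \<xi> a) = a"
proof (induction a rule: word_induct)
  case (word w)
  show ?case
  proof (induction w)
    case Nil
    show ?case by (simp add: comult_linear one_eq_word slice_tens)
  next
    case (Cons i w)
    have "slice counit (letter_comult \<xi> i x) = word [i] * slice counit x" for x
    proof (induction x rule: tens_word_induct)
      case (word u v)
      then show ?case
        by (simp add: letter_comult_tens slice_linear slice_tens word_mult scale_mult)
    qed (simp_all add: slice_linear letter_comult_def lin_ext_add lin_ext_scale distrib_left scale_mult)
    then show ?case
      using Cons comult_letter_mult[of i "word w"] by (simp add: word_mult)
  qed
qed (simp_all add: comult_linear slice_linear)

text \<open>Applying one of the functionals that define the radical to the right factor of \<open>\<Delta> a\<close> is the same as
  taking iterated derivations of \<open>a\<close>.\<close>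

lemma slice_iter_deriv_comult:
  "slice (\<lambda>b. counit (iter_deriv \<xi> w b)) (comult n \<xi> a) = iter_deriv \<xi> w a"
proof (induction w arbitrary: a)
  case Nil
  show ?case by (simp add: slice_counit_comult)
next
  case (Cons j w)
  have "slice (\<lambda>b. counit (iter_deriv \<xi> w (skew_deriv \<xi> j b))) x =
      slice (\<lambda>b. counit (iter_deriv \<xi> w b)) (deriv_right \<xi> j x)" for x
    by (induction x rule: tens_word_induct)
      (simp_all add: slice_linear deriv_right_linear deriv_right_tens slice_tens iter_deriv_linear
        skew_deriv_linear)
  then show ?case by (simp add: deriv_right_comult Cons)
qed

end

text \<open>The linear algebra behind the coideal property: a tensor all of whose slices by the defining
  functionals of the radical \<open>J\<close> lie in \<open>J\<close> belongs to \<open>J \<otimes> T + T \<otimes> J\<close>.  The proof is Gaussian elimination on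
  the right factors.  If \<open>e v\<^sub>0\<close> is not in \<open>J\<close>, some defining functional is nonzero on it, and subtracting
  multiples of \<open>e v\<^sub>0\<close> makes all other right factors vanish under this functional.  The left factor that
  \<open>e v\<^sub>0\<close> collects on the way is then a slice of the tensor, hence in \<open>J\<close>.\<close>

lemma sum_tens_in_radical:
  fixes \<xi> :: "'k::field"
  assumes "finite V" "\<And>v. v \<in> V \<Longrightarrow> d v \<in> carrier (tensor_algebra n)"
    "\<And>v. v \<in> V \<Longrightarrow> e v \<in> carrier (tensor_algebra n)"
    "\<And>w. (\<Sum>v\<in>V. scale (counit (iter_deriv \<xi> w (e v))) (d v)) \<in> deriv_radical n \<xi>"
  shows "(\<Sum>v\<in>V. tens (d v) (e v)) \<in>
    pm.span (tens_sub (deriv_radical n \<xi>) (carrier (tensor_algebra n)) \<union>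
             tens_sub (carrier (tensor_algebra n)) (deriv_radical n \<xi>))"
  using assms
proof (induction V arbitrary: e rule: finite_induct)
  case empty
  show ?case by (simp add: pm.span_zero)
next
  case (insert v0 V)
  let ?T = "carrier (tensor_algebra n) :: (nat list \<Rightarrow>\<^sub>0 'k) set" and ?J = "deriv_radical n \<xi>"
  let ?D = "pm.span (tens_sub ?J ?T \<union> tens_sub ?T ?J)"
  have left: "tens p q \<in> ?D" if "p \<in> ?J" "q \<in> ?T" for p q
    using that unfolding tens_sub_def by (blast intro: pm.span_base)
  have right: "tens p q \<in> ?D" if "p \<in> ?T" "q \<in> ?J" for p q
    using that unfolding tens_sub_def by (blast intro: pm.span_base)
  show ?case
  proof (cases "e v0 \<in> ?J")
    case True
    then have "counit (iter_deriv \<xi> w (e v0)) = 0" for w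
      by (simp add: deriv_radical_def)
    then have "(\<Sum>v\<in>V. tens (d v) (e v)) \<in> ?D"
      using insert.hyps insert.prems(1,2) insert.prems(3) by (intro insert.IH) simp_all
    then show ?thesis
      using insert.hyps insert.prems(1) True right by (simp add: pm.span_add)
  next
    case False
    then obtain w0 where "counit (iter_deriv \<xi> w0 (e v0)) \<noteq> 0"
      using insert.prems(2) by (auto simp: deriv_radical_def)
    define F where "F = (\<lambda>w b. counit (iter_deriv \<xi> w b))"
    define c where "c v = F w0 (e v) / F w0 (e v0)" for v
    define e' where "e' v = e v - scale (c v) (e v0)" for v
    define s where "s = d v0 + (\<Sum>v\<in>V. scale (c v) (d v))"
    have F_lin: "F w (a - scale c b) = F w a - c * F w b" for w a c b
      using iter_deriv_linear(1)[of \<xi> w a "scale (-c) b"] iter_deriv_linear(2)[of \<xi> w "-c" b]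
      by (simp add: F_def)
    have c0: "F w0 (e v0) \<noteq> 0" by (simp add: F_def) fact
    have prem: "scale (F w (e v0)) (d v0) + (\<Sum>v\<in>V. scale (F w (e v)) (d v)) \<in> ?J" for w
      using insert.prems(3)[of w] insert.hyps by (simp add: F_def)
    have "s = scale (1 / F w0 (e v0)) (scale (F w0 (e v0)) (d v0) + (\<Sum>v\<in>V. scale (F w0 (e v)) (d v)))"
      using c0 by (simp add: s_def c_def pm.scale_right_distrib pm.scale_sum_right)
    then have s: "s \<in> ?J"
      using pm.subspace_scale[OF subspace_deriv_radical prem] by metis
    have e'_sum: "(\<Sum>v\<in>V. scale (F w (e' v)) (d v)) =
        (scale (F w (e v0)) (d v0) + (\<Sum>v\<in>V. scale (F w (e v)) (d v))) - scale (F w (e v0)) s" for w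
      by (simp add: e'_def F_lin s_def pm.scale_left_diff_distrib pm.scale_right_distrib
          pm.scale_sum_right sum_subtractf mult.commute)
    have "(\<Sum>v\<in>V. scale (F w (e' v)) (d v)) \<in> ?J" for w
      unfolding e'_sum
      by (intro pm.subspace_diff[OF subspace_deriv_radical prem] pm.subspace_scale[OF subspace_deriv_radical s])
    moreover have "e' v \<in> ?T" if "v \<in> V" for v
      using insert.prems(2) that unfolding e'_def
      by (intro pm.subspace_diff[OF subspace_ta] pm.subspace_scale[OF subspace_ta]) auto
    ultimately have "(\<Sum>v\<in>V. tens (d v) (e' v)) \<in> ?D"
      using insert.prems(1) by (intro insert.IH) (simp_all add: F_def)
    moreover have "tens s (e v0) \<in> ?D"
      using s insert.prems(2) by (intro left) auto
    moreover have "(\<Sum>v\<in>insert v0 V. tens (d v) (e v)) = (\<Sum>v\<in>V. tens (d v) (e' v)) + tens s (e v0)"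
    proof -
      have "tens (d v) (e v) = tens (d v) (e' v) + tens (scale (c v) (d v)) (e v0)" for v
        by (simp add: e'_def tens_scale_left flip: tens_scale_right' tens_add_right)
      then show ?thesis
        using insert.hyps by (simp add: s_def tens_add_left tens_sum_left sum.distrib)
    qed
    ultimately show ?thesis by (simp add: pm.span_add)
  qed
qed

lemma lin_ext_closed:
  assumes "\<And>w. w \<in> lists {1..<n} \<Longrightarrow> f w \<in> carrier (tensor_algebra n)" "a \<in> carrier (tensor_algebra n)"
  shows "lin_ext f a \<in> carrier (tensor_algebra n)"
  unfolding lin_ext_def
  using assms(2) by (intro pm.subspace_sum[OF subspace_ta] pm.subspace_scale[OF subspace_ta] assms(1))
    (auto simp: ta_simps)

lemma word_closed: "w \<in> lists {1..<n} \<Longrightarrow> word w \<in> carrier (tensor_algebra n)"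
  by (simp add: ta_simps word_def)

lemma iter_deriv_append: "iter_deriv \<xi> (u @ v) a = iter_deriv \<xi> v (iter_deriv \<xi> u a)"
  by (induction u arbitrary: a) simp_all

section \<open>The antipode\<close>

text \<open>The mirror image of \<^term>\<open>deriv_word\<close>, which extracts \<open>s\<^sub>j\<close> to the left.  Moving \<open>s\<^sub>j\<close> past a
  letter \<open>s\<^sub>i\<close> on its left gives a factor \<open>\<xi>\<^sup>i\<close>.  The additional factor \<open>\<xi>\<^sup>j\<close> for every letter that
  remains turns the relation with the antipode, \<open>skew_deriv_antipode\<close>, into one without scalars.\<close>

primrec left_deriv_word :: "'k::field \<Rightarrow> nat \<Rightarrow> nat list \<Rightarrow> (nat list \<Rightarrow>\<^sub>0 'k)" where
  "left_deriv_word \<xi> j [] = 0"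
| "left_deriv_word \<xi> j (i # w) =
     (if i = j then act \<xi> j (word w) else 0) + scale (\<xi> ^ (i + j)) (word [i] * left_deriv_word \<xi> j w)"

definition left_deriv :: "'k::field \<Rightarrow> nat \<Rightarrow> (nat list \<Rightarrow>\<^sub>0 'k) \<Rightarrow> (nat list \<Rightarrow>\<^sub>0 'k)" where
  "left_deriv \<xi> j = lin_ext (left_deriv_word \<xi> j)"

lemma left_deriv_linear:
  "left_deriv \<xi> j (a + b) = left_deriv \<xi> j a + left_deriv \<xi> j b"
  "left_deriv \<xi> j (scale c a) = scale c (left_deriv \<xi> j a)"
  "left_deriv \<xi> j 0 = 0"
  by (simp_all add: left_deriv_def lin_ext_add lin_ext_scale lin_ext_zero)

lemma left_deriv_letter_mult:
  "left_deriv \<xi> j (word [i] * a) =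
     (if i = j then act \<xi> j a else 0) + scale (\<xi> ^ (i + j)) (word [i] * left_deriv \<xi> j a)"
  by (induction a rule: word_induct)
    (simp_all add: left_deriv_def lin_ext_word word_mult lin_ext_add lin_ext_scale distrib_left
      scale_mult act_add act_scale pm.scale_right_distrib mult.commute)

lemma left_deriv_one: "left_deriv \<xi> j (word []) = 0"
  by (simp add: left_deriv_def lin_ext_word)

lemma left_deriv_act: "left_deriv \<xi> j (act \<xi> m a) = scale (\<xi> ^ m) (act \<xi> m (left_deriv \<xi> j a))"
proof (induction a rule: word_induct)
  case (word w)
  show ?case
  proof (induction w)
    case Nil
    show ?case by (simp add: act_word left_deriv_linear left_deriv_one act_zero)
  next
    case (Cons i w)
    have *: "word (i # w) = word [i] * word w" by (simp add: word_mult)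
    show ?case
      unfolding * act_mult
      unfolding act_word[of _ _ "[i]"] scale_mult left_deriv_linear left_deriv_letter_mult Cons
      by (simp add: act_add act_scale act_mult act_word scale_mult pm.scale_right_distrib act_zero ac_simps)
  qed
qed (simp_all add: left_deriv_linear act_add act_scale pm.scale_right_distrib mult.commute)

text \<open>Up to the scalar that comes from the normalisation, extracting a letter on the left commutes with
  extracting a letter on the right: this is coassociativity again.\<close>

lemma skew_deriv_left_deriv:
  "skew_deriv \<xi> i (left_deriv \<xi> j a) = scale (\<xi> ^ j) (left_deriv \<xi> j (skew_deriv \<xi> i a))"
proof (induction a rule: word_induct)
  case (word w)
  show ?case
  proof (induction w)
    case Nil
    show ?case by (simp add: left_deriv_one skew_deriv_word left_deriv_linear skew_deriv_linear)
  next
    case (Cons k w)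
    have *: "word (k # w) = word [k] * word w" by (simp add: word_mult)
    show ?case
      unfolding * left_deriv_letter_mult skew_deriv_mult skew_deriv_linear left_deriv_linear Cons skew_deriv_letter
      by (simp add: skew_deriv_act left_deriv_act skew_deriv_linear left_deriv_linear scale_mult
          pm.scale_right_distrib power_add ac_simps)
  qed
qed (simp_all add: left_deriv_linear skew_deriv_linear pm.scale_right_distrib mult.commute)

lemma counit_left_deriv: "counit (left_deriv \<xi> j a) = counit (skew_deriv \<xi> j a)"
proof (induction a rule: word_induct)
  case (word w)
  show ?case
  proof (cases w)
    case Nil
    then show ?thesis by (simp add: left_deriv_one skew_deriv_word)
  next
    case (Cons i v)
    have *: "word w = word [i] * word v" by (simp add: word_mult Cons)
    have "counit (word [i] * b) = 0" for b :: "nat list \<Rightarrow>\<^sub>0 'a"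
      by (induction b rule: word_induct) (simp_all add: word_mult distrib_left scale_mult)
    then show ?thesis unfolding * left_deriv_letter_mult skew_deriv_mult skew_deriv_letter by simp
  qed
qed (simp_all add: left_deriv_linear skew_deriv_linear)

lemma left_deriv_closed:
  assumes "a \<in> carrier (tensor_algebra n)"
  shows "left_deriv \<xi> j a \<in> carrier (tensor_algebra n)"
  unfolding left_deriv_def
proof (rule lin_ext_closed[OF _ assms])
  fix w assume "w \<in> lists {1..<n}"
  then show "left_deriv_word \<xi> j w \<in> carrier (tensor_algebra n)"
  proof (induction w)
    case Nil
    show ?case by (simp add: pm.subspace_0 subspace_ta)
  next
    case (Cons i w)
    then have "word w \<in> carrier (tensor_algebra n)" "word [i] \<in> carrier (tensor_algebra n)"
      by (auto intro: word_closed)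
    then show ?case
      using Cons by (auto simp: act_word pm.subspace_0 subspace_ta
          intro!: pm.subspace_add[OF subspace_ta] pm.subspace_scale[OF subspace_ta] ta_mult_closed)
  qed
qed

text \<open>The left derivation commutes with iterated derivations up to a scalar, so it can be applied last; its
  constant term then agrees with that of the right derivation.\<close>

lemma left_deriv_in_deriv_radical:
  assumes "a \<in> deriv_radical n \<xi>"
  shows "left_deriv \<xi> j a \<in> deriv_radical n \<xi>"
proof -
  have "\<exists>c. iter_deriv \<xi> w (left_deriv \<xi> j b) = scale c (left_deriv \<xi> j (iter_deriv \<xi> w b))" for w b
  proof (induction w arbitrary: b)
    case Nil
    show ?case by (rule exI[of _ 1]) simp
  next
    case (Cons i w)
    obtain c where "iter_deriv \<xi> w (left_deriv \<xi> j (skew_deriv \<xi> i b)) =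
        scale c (left_deriv \<xi> j (iter_deriv \<xi> w (skew_deriv \<xi> i b)))"
      using Cons by blast
    then show ?case
      by (intro exI[of _ "\<xi> ^ j * c"]) (simp add: skew_deriv_left_deriv iter_deriv_linear)
  qed
  moreover have "counit (left_deriv \<xi> j (iter_deriv \<xi> w a)) = 0" for w
  proof -
    have "counit (iter_deriv \<xi> (w @ [j]) a) = 0" using assms by (simp add: deriv_radical_def)
    then show ?thesis by (simp add: iter_deriv_append counit_left_deriv)
  qed
  ultimately have "counit (iter_deriv \<xi> w (left_deriv \<xi> j a)) = 0" for w
    by (metis counit_simps(2) mult_zero_right)
  then show ?thesis
    using assms left_deriv_closed by (auto simp: deriv_radical_def)
qed

lemma antipode_linear:
  "antipode n \<xi> (a + b) = antipode n \<xi> a + antipode n \<xi> b"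
  "antipode n \<xi> (scale c a) = scale c (antipode n \<xi> a)"
  "antipode n \<xi> 0 = 0"
  "antipode n \<xi> (word w) = antipode_word n \<xi> w"
  by (simp_all add: antipode_def lin_ext_add lin_ext_scale lin_ext_zero lin_ext_word)

lemma antipode_letter_mult:
  assumes "\<xi> ^ n = 1"
  shows "antipode n \<xi> (word [i] * a) = - (antipode n \<xi> (act \<xi> i a) * word [i])"
  by (induction a rule: word_induct)
    (simp_all add: antipode_linear word_mult antipode_word_Cons cdeg_def power_mod_root[OF assms]
      distrib_left distrib_right act_add act_scale act_word scale_mult del: antipode_word.simps)

text \<open>The antipode reverses words and therefore interchanges the two kinds of derivations.\<close>

lemma skew_deriv_antipode:
  assumes "\<xi> ^ n = 1"
  shows "skew_deriv \<xi> j (antipode n \<xi> a) = - antipode n \<xi> (left_deriv \<xi> j a)"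
proof (induction a rule: word_induct)
  case (word w)
  show ?case
  proof (induction w)
    case Nil
    show ?case by (simp add: antipode_linear skew_deriv_one left_deriv_one)
  next
    case (Cons i w)
    have *: "word (i # w) = word [i] * word w" by (simp add: word_mult)
    have "skew_deriv \<xi> j (antipode n \<xi> (act \<xi> i (word w))) =
        - antipode n \<xi> (left_deriv \<xi> j (act \<xi> i (word w)))"
      using Cons by (simp add: act_word antipode_linear skew_deriv_linear left_deriv_linear)
    then have "skew_deriv \<xi> j (antipode n \<xi> (act \<xi> i (word w))) =
        - scale (\<xi> ^ i) (antipode n \<xi> (act \<xi> i (left_deriv \<xi> j (word w))))"
      by (simp add: left_deriv_act antipode_linear)
    then show ?case
      unfolding * antipode_letter_mult[OF assms] left_deriv_letter_mult skew_deriv_linear skew_deriv_mult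
      by (simp add: skew_deriv_letter antipode_linear antipode_letter_mult[OF assms] act_scale act_word[of _ _ "[i]"]
          scale_mult power_add mult.commute)
  qed
qed (simp_all add: antipode_linear left_deriv_linear skew_deriv_linear)

lemma antipode_closed:
  assumes "a \<in> carrier (tensor_algebra n)"
  shows "antipode n \<xi> a \<in> carrier (tensor_algebra n)"
  unfolding antipode_def
proof (rule lin_ext_closed[OF _ assms])
  fix w assume "w \<in> lists {1..<n}"
  then show "antipode_word n \<xi> w \<in> carrier (tensor_algebra n)"
  proof (induction w)
    case Nil
    show ?case by (simp add: ta_one_closed)
  next
    case (Cons i w)
    then show ?case
      unfolding antipode_word_Cons
      by (intro pm.subspace_scale[OF subspace_ta] ta_mult_closed word_closed) auto
  qed
qed

lemma antipode_in_deriv_radical: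
  assumes "\<xi> ^ n = 1" "a \<in> deriv_radical n \<xi>"
  shows "antipode n \<xi> a \<in> deriv_radical n \<xi>"
proof -
  have "counit (antipode n \<xi> b) = counit b" for b
  proof (induction b rule: word_induct)
    case (word w)
    show ?case
    proof (cases w)
      case Nil
      then show ?thesis by (simp add: antipode_linear one_eq_word)
    next
      case (Cons i v)
      have "counit (b * word [i]) = 0" for b :: "nat list \<Rightarrow>\<^sub>0 'a"
        by (induction b rule: word_induct) (simp_all add: word_mult distrib_right scale_mult)
      then show ?thesis by (simp add: Cons antipode_linear antipode_word_Cons del: antipode_word.simps)
    qed
  qed (simp_all add: antipode_linear)
  then have "counit (iter_deriv \<xi> w (antipode n \<xi> b)) = 0" if "b \<in> deriv_radical n \<xi>" for w b
    using that
  proof (induction w arbitrary: b)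
    case Nil
    then have "counit (iter_deriv \<xi> [] b) = 0" unfolding deriv_radical_def by blast
    then show ?case using Nil by simp
  next
    case (Cons j w)
    then show ?case
      by (simp add: skew_deriv_antipode[OF assms(1)] iter_deriv_linear left_deriv_in_deriv_radical)
  qed
  then show ?thesis
    using assms(2) antipode_closed by (auto simp: deriv_radical_def)
qed

section \<open>The Nichols ideal as a radical\<close>

lemma keys_comult:
  assumes "a \<in> carrier (tensor_algebra n)" "(u, v) \<in> Poly_Mapping.keys (comult m \<xi> a)"
  shows "u \<in> lists {1..<n} \<and> v \<in> lists {1..<n}"
proof -
  let ?S = "{x. Poly_Mapping.keys x \<subseteq> lists {1..<n} \<times> lists {1..<n}}"
  have "comult m \<xi> a \<in> ?S"
    unfolding comult_def lin_ext_def
  proof (intro pm.subspace_sum[OF subspace_keys] pm.subspace_scale[OF subspace_keys])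
    fix w assume "w \<in> Poly_Mapping.keys a"
    then have w: "set w \<subseteq> {1..<n}" using assms(1) unfolding ta_simps by blast
    show "comult_word m \<xi> w \<in> ?S"
    proof safe
      fix u v i assume uv: "(u, v) \<in> Poly_Mapping.keys (comult_word m \<xi> w)"
      then have "set u \<union> set v = set w"
        using keys_comult_word_mset[OF uv] by (metis set_mset_mset set_mset_union)
      then show "i \<in> set u \<Longrightarrow> i \<in> {1..<n}" "i \<in> set v \<Longrightarrow> i \<in> {1..<n}" using w by blast+
    qed
  qed
  then show ?thesis using assms(2) by blast
qed

lemma comult_deriv_radical:
  assumes "\<xi> ^ n = 1" "a \<in> deriv_radical n \<xi>"
  shows "comult n \<xi> a \<in>
    pm.span (tens_sub (deriv_radical n \<xi>) (carrier (tensor_algebra n)) \<union>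
             tens_sub (carrier (tensor_algebra n)) (deriv_radical n \<xi>))"
proof (subst sum_tens_slices(1)[of "comult n \<xi> a"], rule sum_tens_in_radical)
  have a: "a \<in> carrier (tensor_algebra n)" using assms(2) by (simp add: deriv_radical_def)
  show "(\<Sum>u\<in>fst ` Poly_Mapping.keys (comult n \<xi> a).
      scale (Poly_Mapping.lookup (comult n \<xi> a) (u, v)) (word u)) \<in> carrier (tensor_algebra n)" for v
    using keys_comult[OF a]
    by (intro pm.subspace_sum[OF subspace_ta] pm.subspace_scale[OF subspace_ta] word_closed) force
  show "word v \<in> carrier (tensor_algebra n)" if "v \<in> snd ` Poly_Mapping.keys (comult n \<xi> a)" for v
    using keys_comult[OF a] that by (force intro: word_closed)
  have "iter_deriv \<xi> w a \<in> deriv_radical n \<xi>" for w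
    using assms(2) by (induction w arbitrary: a) (simp_all add: skew_deriv_in_deriv_radical)
  then show "(\<Sum>v\<in>snd ` Poly_Mapping.keys (comult n \<xi> a). scale (counit (iter_deriv \<xi> w (word v)))
      (\<Sum>u\<in>fst ` Poly_Mapping.keys (comult n \<xi> a).
        scale (Poly_Mapping.lookup (comult n \<xi> a) (u, v)) (word u))) \<in> deriv_radical n \<xi>" for w
    by (simp add: slice_iter_deriv_comult[OF assms(1)]
        flip: sum_tens_slices(2)[of "\<lambda>b. counit (iter_deriv \<xi> w b)"])
qed simp

text \<open>The constant term and the coefficients of the letters are themselves iterated derivations.\<close>

lemma lookup_deriv_radical:
  assumes "a \<in> deriv_radical n \<xi>" "length v < 2"
  shows "Poly_Mapping.lookup a v = 0"
proof (cases v)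
  case Nil
  have "counit (iter_deriv \<xi> [] a) = 0" using assms(1) unfolding deriv_radical_def by blast
  then show ?thesis by (simp add: Nil counit_def)
next
  case (Cons j v')
  then have v: "v = [j]" using assms(2) by simp
  have "counit (iter_deriv \<xi> [j] a) = 0" using assms(1) unfolding deriv_radical_def by blast
  then show ?thesis by (simp add: v counit_skew_deriv)
qed

lemma deriv_radical_generated:
  fixes \<xi> :: "'k::field" and n :: nat
  defines "G \<equiv> deriv_radical n \<xi> \<inter> (\<Union>d\<in>{2..}. homogeneous n d)"
  shows "deriv_radical n \<xi> = Idl\<^bsub>tensor_algebra n\<^esub> G"
proof
  interpret ring "tensor_algebra n :: (nat list \<Rightarrow>\<^sub>0 'k) ring" by (rule ring_tensor_algebra)
  have G: "G \<subseteq> carrier (tensor_algebra n)" by (auto simp: G_def deriv_radical_def)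
  show "Idl\<^bsub>tensor_algebra n\<^esub> G \<subseteq> deriv_radical n \<xi>"
    by (rule genideal_minimal[OF ideal_deriv_radical]) (simp add: G_def)
  show "deriv_radical n \<xi> \<subseteq> Idl\<^bsub>tensor_algebra n\<^esub> G"
  proof
    fix a assume a: "a \<in> deriv_radical n \<xi>"
    define part where "part d = lin_ext (\<lambda>v. scale (if length v = d then 1 else 0) (word v)) a" for d
    have part: "part d \<in> deriv_radical n \<xi>" for d
      unfolding part_def using a by (rule part_in_deriv_radical[rotated]) (metis mset_eq_length)
    have keys: "Poly_Mapping.keys (part d) \<subseteq> {v. length v = d}" for d
      by (auto simp: part_def keys_lin_ext_scale)
    have sub: "pm.subspace (Idl\<^bsub>tensor_algebra n\<^esub> G)"
      by (rule subspace_ideal[OF genideal_ideal[OF G]])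
    have "part d \<in> Idl\<^bsub>tensor_algebra n\<^esub> G" for d
    proof (cases "d \<ge> 2")
      case True
      have "part d \<in> G"
        using True part[of d] keys[of d]
      by (auto simp: G_def homogeneous_def deriv_radical_def intro!: bexI[of _ d])
      then show ?thesis using genideal_self[OF G] by blast
    next
      case False
      have "Poly_Mapping.lookup (part d) v = 0" for v
        using keys[of d] False lookup_deriv_radical[OF part[of d], of v]
        by (cases "length v = d") (auto simp: in_keys_iff)
      then have "part d = 0" by (intro poly_mapping_eqI) simp
      then show ?thesis using pm.subspace_0[OF sub] by simp
    qed
    moreover have "a = (\<Sum>d\<in>length ` Poly_Mapping.keys a. part d)"
      by (rule poly_mapping_eqI)
        (auto simp: part_def lookup_sum lookup_lin_ext_scale in_keys_iff if_distrib[of "\<lambda>c. c * _"] cong: if_cong)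
    ultimately show "a \<in> Idl\<^bsub>tensor_algebra n\<^esub> G"
      by (metis (no_types, lifting) pm.subspace_sum[OF sub])
  qed
qed

lemma graded_hopf_ideal_deriv_radical:
  assumes "\<xi> ^ n = 1"
  shows "graded_hopf_ideal n \<xi> (deriv_radical n \<xi>)"
  unfolding graded_hopf_ideal_def
proof (intro conjI ballI allI impI)
  show "\<exists>G\<subseteq>\<Union> (homogeneous n ` {2..}). deriv_radical n \<xi> = Idl\<^bsub>tensor_algebra n\<^esub> G"
    using deriv_radical_generated by blast
  fix a assume a: "a \<in> deriv_radical n \<xi>"
  show "act \<xi> m a \<in> deriv_radical n \<xi>" for m by (rule act_in_deriv_radical[OF a])
  show "ccomp n h a \<in> deriv_radical n \<xi>" for h
  proof -
    have "ccomp n h a = lin_ext (\<lambda>v. scale (if cdeg n v = h then 1 else 0) (word v)) a"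
      unfolding ccomp_def by (rule lin_ext_cong) simp
    moreover have "cdeg n u = cdeg n v" if "mset u = mset v" for u v
      using that by (metis cdeg_def sum_mset_sum_list)
    ultimately show ?thesis
      using part_in_deriv_radical[OF _ a, of "\<lambda>v. if cdeg n v = h then 1 else 0"] by metis
  qed
  show "counit a = 0" using lookup_deriv_radical[OF a, of "[]"] by (simp add: counit_def)
  show "antipode n \<xi> a \<in> deriv_radical n \<xi>" by (rule antipode_in_deriv_radical[OF assms a])
  show "comult n \<xi> a \<in> pm.span (tens_sub (deriv_radical n \<xi>) (carrier (tensor_algebra n)) \<union>
      tens_sub (carrier (tensor_algebra n)) (deriv_radical n \<xi>))"
    by (rule comult_deriv_radical[OF assms a])
qed

lemma lookup_graded_hopf_ideal:
  fixes \<xi> :: "'k::field"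
  assumes "graded_hopf_ideal n \<xi> I" "a \<in> I" "length v < 2"
  shows "Poly_Mapping.lookup a v = 0"
proof -
  interpret ring "tensor_algebra n :: (nat list \<Rightarrow>\<^sub>0 'k) ring" by (rule ring_tensor_algebra)
  let ?L = "{w. set w \<subseteq> {1..<n} \<and> length w \<ge> 2}"
  let ?K = "{b :: nat list \<Rightarrow>\<^sub>0 'k. Poly_Mapping.keys b \<subseteq> ?L}"
  obtain G where G: "G \<subseteq> (\<Union>d\<in>{2..}. homogeneous n d)" "I = Idl\<^bsub>tensor_algebra n\<^esub> G"
    using assms(1) unfolding graded_hopf_ideal_def by blast
  have "ideal ?K (tensor_algebra n)"
  proof (rule ideal_subspace[OF subspace_keys])
    show "?K \<subseteq> carrier (tensor_algebra n)" by (auto simp: ta_simps)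
    fix b x :: "nat list \<Rightarrow>\<^sub>0 'k" assume b: "b \<in> ?K" and x: "x \<in> carrier (tensor_algebra n)"
    then show "x * b \<in> ?K" "b * x \<in> ?K"
      using keys_mult[of x b] keys_mult[of b x] by (fastforce simp: ta_simps plus_list_def)+
  qed
  moreover have "G \<subseteq> ?K"
    using G(1) by (fastforce simp: homogeneous_def ta_simps)
  ultimately have "I \<subseteq> ?K" unfolding G(2) by (rule genideal_minimal)
  then show ?thesis using assms(2,3) by (fastforce simp: in_keys_iff)
qed

text \<open>Extract the coefficient of \<open>s\<^sub>j\<close> from the right factor of \<open>\<Delta> a \<in> I \<otimes> T + T \<otimes> I\<close>: the second summand
  does not contribute because elements of \<open>I\<close> start in degree two.\<close>

lemma skew_deriv_graded_hopf_ideal: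
  fixes \<xi> :: "'k::field"
  assumes "\<xi> ^ n = 1" "graded_hopf_ideal n \<xi> I" "a \<in> I"
  shows "skew_deriv \<xi> j a \<in> I"
proof -
  have I: "pm.subspace I" by (rule subspace_ideal[OF ideal_graded_hopf_ideal[OF assms(2)]])
  let ?\<phi> = "\<lambda>b :: nat list \<Rightarrow>\<^sub>0 'k. counit (skew_deriv \<xi> j b)"
  have tens: "slice ?\<phi> (tens p q) = scale (Poly_Mapping.lookup q [j]) p" for p q
    by (subst slice_tens) (simp_all add: skew_deriv_linear counit_skew_deriv)
  have "comult n \<xi> a \<in> pm.span (tens_sub I (carrier (tensor_algebra n)) \<union> tens_sub (carrier (tensor_algebra n)) I)"
    using assms(2,3) unfolding graded_hopf_ideal_def by blast
  also have "\<dots> \<subseteq> {x. slice ?\<phi> x \<in> I}"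
  proof (intro pm.span_minimal Un_least)
    show sub: "pm.subspace {x. slice ?\<phi> x \<in> I}"
      using I by (auto simp: pm.subspace_def slice_linear)
    show "tens_sub I (carrier (tensor_algebra n)) \<subseteq> {x. slice ?\<phi> x \<in> I}"
      unfolding tens_sub_def using pm.subspace_scale[OF I]
      by (intro pm.span_minimal[OF _ sub]) (auto simp: tens)
    show "tens_sub (carrier (tensor_algebra n)) I \<subseteq> {x. slice ?\<phi> x \<in> I}"
      unfolding tens_sub_def using lookup_graded_hopf_ideal[OF assms(2)] pm.subspace_0[OF I]
      by (intro pm.span_minimal[OF _ sub]) (auto simp: tens)
  qed
  finally show ?thesis using slice_iter_deriv_comult[OF assms(1), of "[j]" a] by simp
qed

theorem nichols_ideal_eq_deriv_radical:
  assumes "\<xi> ^ n = 1"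
  shows "nichols_ideal n \<xi> = deriv_radical n \<xi>"
proof
  show "deriv_radical n \<xi> \<subseteq> nichols_ideal n \<xi>"
    by (rule nichols_ideal_greatest(2)[OF graded_hopf_ideal_deriv_radical[OF assms]])
  show "nichols_ideal n \<xi> \<subseteq> deriv_radical n \<xi>"
  proof
    fix a assume a: "a \<in> nichols_ideal n \<xi>"
    have "iter_deriv \<xi> w b \<in> nichols_ideal n \<xi>" if "b \<in> nichols_ideal n \<xi>" for w b
      using that
      by (induction w arbitrary: b)
        (simp_all add: skew_deriv_graded_hopf_ideal[OF assms nichols_ideal_greatest(1)])
    then have "counit (iter_deriv \<xi> w a) = 0" for w
      using lookup_graded_hopf_ideal[OF nichols_ideal_greatest(1), of _ n \<xi> "[]"] a
      by (simp add: counit_def)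
    then show "a \<in> deriv_radical n \<xi>"
      using ideal.Icarr[OF ideal_nichols_ideal a] by (simp add: deriv_radical_def)
  qed
qed

section \<open>The braided adjoint action\<close>

definition braided_ad :: "'k::field \<Rightarrow> nat \<Rightarrow> (nat list \<Rightarrow>\<^sub>0 'k) \<Rightarrow> (nat list \<Rightarrow>\<^sub>0 'k)" where
  "braided_ad \<xi> i a = word [i] * a - act \<xi> i a * word [i]"

text \<open>For \<open>i = j\<close> the two terms in which \<open>\<partial>\<^sub>j\<close> hits \<open>s\<^sub>i\<close> cancel, so the same formula holds for all
  \<open>j\<close>.  Consequently \<open>ad s\<^sub>i\<close> preserves the kernel of every \<open>\<partial>\<^sub>j\<close>.\<close>

lemma skew_deriv_braided_ad:
  "skew_deriv \<xi> j (braided_ad \<xi> i a) =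
     word [i] * skew_deriv \<xi> j a - scale (\<xi> ^ (i + j)) (act \<xi> i (skew_deriv \<xi> j a) * word [i])"
  by (auto simp: braided_ad_def skew_deriv_linear skew_deriv_mult skew_deriv_letter skew_deriv_act
      act_word scale_mult power_add mult.commute)

lemma act_braided_ad:
  "act \<xi> m (braided_ad \<xi> i a) = scale (\<xi> ^ m) (braided_ad \<xi> i (act \<xi> m a))"
proof -
  have "act \<xi> m (act \<xi> i a) = act \<xi> i (act \<xi> m a)"
    by (induction a rule: word_induct) (simp_all add: act_word act_add act_scale mult.commute)
  then show ?thesis
    by (simp add: braided_ad_def act_diff act_mult act_word scale_mult pm.scale_right_diff_distrib)
qed

lemma braided_ad_closed:
  "a \<in> carrier (tensor_algebra n) \<Longrightarrow> i \<in> {1..<n} \<Longrightarrow> braided_ad \<xi> i a \<in> carrier (tensor_algebra n)"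
  unfolding braided_ad_def act_def
  by (intro pm.subspace_diff[OF subspace_ta] ta_mult_closed lin_ext_closed word_closed
      pm.subspace_scale[OF subspace_ta]) auto

section \<open>Powers of an element with trivial self-braiding\<close>

lemma act_power: "act \<xi> m z = scale c z \<Longrightarrow> act \<xi> m (z ^ k) = scale (c ^ k) (z ^ k)"
  by (induction k) (simp_all add: act_one act_mult scale_mult mult.commute)

text \<open>If \<open>\<partial>\<^sub>i\<close> is the only derivation in the list that does not kill \<open>z\<close>, then all derivations in the list have
  to hit the same factor of \<open>z\<^sup>k\<close>, and each factor to the right of it contributes the product of
  the scalars \<open>q\<close>.  This product is the self-braiding of \<open>z\<close> if \<open>z\<close> consists of the letters in the list;
  when it is \<open>1\<close> the composite acts on powers of \<open>z\<close> like an ordinary derivation.\<close>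

lemma iter_deriv_power:
  fixes \<xi> :: "'k::field" and z :: "nat list \<Rightarrow>\<^sub>0 'k"
  assumes "set v \<inter> {j. skew_deriv \<xi> j z \<noteq> 0} = {}"
    and act: "\<And>j. act \<xi> j z = scale (q j) z"
    and "q i * prod_list (map q v) = 1"
    and "iter_deriv \<xi> (i # v) z = scale c 1"
  shows "iter_deriv \<xi> (i # v) (z ^ Suc k) = scale (of_nat (Suc k) * c) (z ^ k)"
proof -
  have z_power: "skew_deriv \<xi> j (z ^ k) = 0" if "j \<in> set v" for j k
    using that assms(1) by (induction k) (auto simp: skew_deriv_one skew_deriv_mult)
  have iter: "iter_deriv \<xi> u (z ^ k * b) = z ^ k * iter_deriv \<xi> u b"
    "iter_deriv \<xi> u (b * z) = scale (prod_list (map q u)) (iter_deriv \<xi> u b * z)"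
    if "set u \<subseteq> set v" for u b k
    using that
    by (induction u arbitrary: b)
      (use assms(1) in \<open>auto simp: skew_deriv_mult z_power act scale_mult iter_deriv_linear mult.commute\<close>)
  show ?thesis
  proof (induction k)
    case 0
    show ?case using assms(4) by simp
  next
    case (Suc k)
    have "iter_deriv \<xi> (i # v) (z ^ Suc k * z) =
        iter_deriv \<xi> v (z ^ Suc k * skew_deriv \<xi> i z) +
        scale (q i) (iter_deriv \<xi> v (skew_deriv \<xi> i (z ^ Suc k) * z))"
      by (simp only: iter_deriv.simps skew_deriv_mult act scale_mult iter_deriv_linear)
    also have "\<dots> = z ^ Suc k * iter_deriv \<xi> (i # v) z +
        scale (q i * prod_list (map q v)) (iter_deriv \<xi> (i # v) (z ^ Suc k) * z)"
      by (simp only: iter[OF order_refl] iter_deriv.simps pm.scale_scale)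
    also have "\<dots> = scale (of_nat (Suc (Suc k)) * c) (z ^ Suc k)"
      unfolding Suc assms(3,4) of_nat_Suc[of "Suc k"] distrib_right
      by (simp only: scale_mult mult_1_right mult_1_left pm.scale_one pm.scale_left_distrib power_Suc2[symmetric])
    finally show ?case by (simp only: power_Suc2[symmetric])
  qed
qed


lemma iter_deriv_one: "w \<noteq> [] \<Longrightarrow> iter_deriv \<xi> w 1 = 0"
  by (cases w) (simp_all add: skew_deriv_one iter_deriv_linear)

lemma iter_deriv_powers:
  fixes \<xi> :: "'k::field_char_0" and z :: "nat list \<Rightarrow>\<^sub>0 'k"
  assumes leibniz: "\<And>m. iter_deriv \<xi> u (z ^ Suc m) = scale (of_nat (Suc m) * c) (z ^ m)" and "u \<noteq> []"
  shows "m < k \<Longrightarrow> iter_deriv \<xi> (concat (replicate k u)) (z ^ m) = 0"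
    and "iter_deriv \<xi> (concat (replicate k u)) (z ^ k) = scale (fact k * c ^ k) 1"
proof -
  show "m < k \<Longrightarrow> iter_deriv \<xi> (concat (replicate k u)) (z ^ m) = 0"
  proof (induction k arbitrary: m)
    case (Suc k)
    show ?case
    proof (cases m)
      case 0
      then show ?thesis using \<open>u \<noteq> []\<close> by (simp add: iter_deriv_one del: concat.simps)
    next
      case (Suc m')
      then show ?thesis
        using Suc.IH[of m'] Suc.prems
        by (simp add: iter_deriv_append leibniz iter_deriv_linear del: power_Suc)
    qed
  qed simp
  show "iter_deriv \<xi> (concat (replicate k u)) (z ^ k) = scale (fact k * c ^ k) 1"
    by (induction k) (simp_all add: iter_deriv_append leibniz iter_deriv_linear mult_ac del: power_Suc of_nat_Suc, simp)
qed

text \<open>By \<open>skew_deriv_braided_ad\<close> only \<open>\<partial>\<^sub>j\<close> does not kill \<open>z\<close>.  It removes the innermost letter and leaves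
  twisted commutators of the other three.  The first factor of the constant comes from the innermost
  commutator, the other two from \<open>\<partial>\<^sub>i\<close> and \<open>\<partial>\<^sub>k\<close>.\<close>

lemma iter_deriv_iterated_ad:
  fixes \<xi> :: "'k::field"
  assumes "distinct [j, i, k, l]"
  defines "z \<equiv> braided_ad \<xi> l (braided_ad \<xi> k (braided_ad \<xi> i (word [j])))"
  shows "skew_deriv \<xi> m z = 0 \<or> m = j"
    and "act \<xi> m z = scale (\<xi> ^ (4 * m)) z"
    and "iter_deriv \<xi> [j, i, k, l] z =
      scale ((1 - \<xi> ^ (i + j)) * (1 - \<xi> ^ (i + j + 2 * k)) * (1 - \<xi> ^ (i + j + k + 3 * l))) 1"
proof -
  have ad_scale: "braided_ad \<xi> p (scale c a) = scale c (braided_ad \<xi> p a)" for p c a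
    by (simp add: braided_ad_def act_scale scale_mult pm.scale_right_diff_distrib)
  show "skew_deriv \<xi> m z = 0 \<or> m = j"
    by (auto simp: z_def skew_deriv_braided_ad skew_deriv_letter act_zero)
  show "act \<xi> m z = scale (\<xi> ^ (4 * m)) z"
    by (simp add: z_def act_braided_ad act_word ad_scale numeral_eq_Suc power_add mult_ac)
  define c where "c = 1 - \<xi> ^ (i + j)"
  define u where "u = word [k] * word [i] - scale (\<xi> ^ (2 * k + j)) (word [i] * word [k])"
  have "skew_deriv \<xi> j (braided_ad \<xi> i (word [j])) = scale c (word [i])"
    by (simp add: skew_deriv_braided_ad skew_deriv_letter act_one c_def pm.scale_left_diff_distrib)
  then have "skew_deriv \<xi> j (braided_ad \<xi> k (braided_ad \<xi> i (word [j]))) = scale c u"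
    by (simp add: skew_deriv_braided_ad act_scale act_word scale_mult u_def pm.scale_right_diff_distrib
        power_add mult_ac mult_2 mult_2_right)
  then have 1: "skew_deriv \<xi> j z = scale c (word [l] * u - scale (\<xi> ^ (3 * l + j)) (u * word [l]))"
    by (simp add: z_def skew_deriv_braided_ad act_scale act_mult act_word act_diff scale_mult u_def
        pm.scale_right_diff_distrib left_diff_distrib right_diff_distrib power_add mult_ac numeral_eq_Suc)
  have u: "skew_deriv \<xi> i u = scale (1 - \<xi> ^ (2 * k + j + i)) (word [k])"
    using assms(1)
    by (simp add: u_def skew_deriv_linear skew_deriv_mult skew_deriv_letter act_word
        pm.scale_left_diff_distrib power_add mult_ac)
  have 2: "skew_deriv \<xi> i (word [l] * u - scale (\<xi> ^ (3 * l + j)) (u * word [l])) =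
      scale (1 - \<xi> ^ (2 * k + j + i)) (word [l] * word [k] - scale (\<xi> ^ (3 * l + j + i)) (word [k] * word [l]))"
    using assms(1)
    by (simp add: skew_deriv_linear skew_deriv_mult skew_deriv_letter act_word scale_mult u
        pm.scale_right_diff_distrib power_add mult_ac)
  have 3: "skew_deriv \<xi> k (word [l] * word [k] - scale (\<xi> ^ (3 * l + j + i)) (word [k] * word [l])) =
      scale (1 - \<xi> ^ (3 * l + j + i + k)) (word [l])"
    using assms(1)
    by (simp add: skew_deriv_linear skew_deriv_mult skew_deriv_letter act_word scale_mult
        pm.scale_left_diff_distrib power_add mult_ac)
  show "iter_deriv \<xi> [j, i, k, l] z =
      scale ((1 - \<xi> ^ (i + j)) * (1 - \<xi> ^ (i + j + 2 * k)) * (1 - \<xi> ^ (i + j + k + 3 * l))) 1"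
    by (simp only: iter_deriv.simps 1 skew_deriv_linear(2) 2 3 skew_deriv_letter)
      (simp add: c_def add_ac mult_ac)
qed

section \<open>Dimension of the Nichols algebra\<close>

lemma tensor_algebra_minus:
  assumes "a \<in> carrier (tensor_algebra n)" "b \<in> carrier (tensor_algebra n)"
  shows "a \<ominus>\<^bsub>tensor_algebra n\<^esub> b = a - b"
proof -
  interpret ring "tensor_algebra n" by (rule ring_tensor_algebra)
  have "\<ominus>\<^bsub>tensor_algebra n\<^esub> b = - b"
    using assms pm.subspace_neg[OF subspace_ta assms(2)]
    by (intro minus_equality) (simp_all add: ta_simps(2-))
  then show ?thesis by (simp add: a_minus_def ta_simps(5))
qed

lemma Span_tensor_algebra:
  fixes us :: "(nat list \<Rightarrow>\<^sub>0 'k::field) list"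
  shows "ring.Span (tensor_algebra n) (range (\<lambda>c. scale c 1)) us = pm.span (set us)"
proof -
  interpret ring "tensor_algebra n :: (nat list \<Rightarrow>\<^sub>0 'k) ring" by (rule ring_tensor_algebra)
  show ?thesis
  proof (induction us)
    case Nil
    show ?case by (simp add: ta_simps(4))
  next
    case (Cons u us)
    have "x \<in> line_extension (range (\<lambda>c. scale c 1)) u (pm.span (set us)) \<longleftrightarrow> x \<in> pm.span (set (u # us))" for x
    proof -
      have "x \<in> line_extension (range (\<lambda>c. scale c 1)) u (pm.span (set us)) \<longleftrightarrow>
          (\<exists>c. \<exists>v\<in>pm.span (set us). x = scale c u + v)"
        by (simp add: line_extension_mem_iff ta_simps(2-) scale_mult)
      also have "\<dots> \<longleftrightarrow> (\<exists>c. x - scale c u \<in> pm.span (set us))"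
        by (metis add_diff_cancel_left' diff_add_cancel add.commute)
      finally show ?thesis by (simp add: pm.span_breakdown_eq)
    qed
    with Cons show ?case by auto
  qed
qed

context
  fixes n :: nat and \<xi> :: "'k::field"
begin

interpretation T: ring "tensor_algebra n :: (nat list \<Rightarrow>\<^sub>0 'k) ring"
  by (rule ring_tensor_algebra)

interpretation N: ideal "nichols_ideal n \<xi>" "tensor_algebra n :: (nat list \<Rightarrow>\<^sub>0 'k) ring"
  by (rule ideal_nichols_ideal)

interpretation h: ring_hom_ring "tensor_algebra n :: (nat list \<Rightarrow>\<^sub>0 'k) ring" "nichols_algebra n \<xi>"
  "(+>\<^bsub>tensor_algebra n\<^esub>) (nichols_ideal n \<xi>)"
  unfolding nichols_algebra_def by (rule N.rcos_ring_hom_ring)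

lemma Span_nichols_algebra:
  assumes "set us \<subseteq> carrier (tensor_algebra n)"
  shows "ring.Span (nichols_algebra n \<xi>) (nichols_scalars n \<xi>)
      (map ((+>\<^bsub>tensor_algebra n\<^esub>) (nichols_ideal n \<xi>)) us) =
    (+>\<^bsub>tensor_algebra n\<^esub>) (nichols_ideal n \<xi>) ` pm.span (set us)"
proof -
  have "range (\<lambda>c::'k. scale c (1 :: nat list \<Rightarrow>\<^sub>0 'k)) \<subseteq> carrier (tensor_algebra n)"
    using pm.subspace_scale[OF subspace_ta ta_one_closed] by auto
  from h.Span_hom[OF this assms] show ?thesis
    by (simp only: nichols_scalars_def Span_tensor_algebra image_image)
qed

lemma coset_eq_iff:
  assumes "a \<in> carrier (tensor_algebra n)" "b \<in> carrier (tensor_algebra n)"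
  shows "nichols_ideal n \<xi> +>\<^bsub>tensor_algebra n\<^esub> a = nichols_ideal n \<xi> +>\<^bsub>tensor_algebra n\<^esub> b \<longleftrightarrow>
    a - b \<in> nichols_ideal n \<xi>"
  using T.quotient_eq_iff_same_a_r_cos[OF N.ideal_axioms assms] tensor_algebra_minus[OF assms] by simp

lemma finite_dimension_nichols_algebra:
  fixes W :: "(nat list \<Rightarrow>\<^sub>0 'k) set"
  assumes "finite W" "W \<subseteq> carrier (tensor_algebra n)"
    "carrier (tensor_algebra n) \<subseteq> pm.span (W \<union> nichols_ideal n \<xi>)"
  shows "ring.finite_dimension (nichols_algebra n \<xi>) (nichols_scalars n \<xi>) (carrier (nichols_algebra n \<xi>))"
proof -
  let ?h = "(+>\<^bsub>tensor_algebra n\<^esub>) (nichols_ideal n \<xi>)"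
  obtain us where us: "set us = W" using finite_list[OF assms(1)] by blast
  have sub: "pm.subspace (nichols_ideal n \<xi>)" by (simp add: nichols_ideal_def)
  have "?h ` carrier (tensor_algebra n) \<subseteq> ?h ` pm.span W"
  proof safe
    fix a :: "nat list \<Rightarrow>\<^sub>0 'k"
    assume a: "a \<in> carrier (tensor_algebra n)"
    then obtain b c where bc: "a = b + c" "b \<in> pm.span W" "c \<in> nichols_ideal n \<xi>"
      using assms(3) pm.span_eq_iff[THEN iffD2, OF sub] unfolding pm.span_Un by blast
    have "b \<in> carrier (tensor_algebra n)"
      using bc(2) pm.span_minimal[OF assms(2) subspace_ta] by blast
    then have "?h a = ?h b" using a bc(1,3) by (simp add: coset_eq_iff)
    then show "?h a \<in> ?h ` pm.span W" using bc(2) by blast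
  qed
  moreover have "?h ` pm.span W \<subseteq> ?h ` carrier (tensor_algebra n)"
    using pm.span_minimal[OF assms(2) subspace_ta] by blast
  moreover have "carrier (nichols_algebra n \<xi>) = ?h ` carrier (tensor_algebra n)"
    unfolding nichols_algebra_def FactRing_def A_RCOSETS_def' partial_object.simps by blast
  ultimately have "carrier (nichols_algebra n \<xi>) = ?h ` pm.span (set us)"
    unfolding us by (simp only: subset_antisym)
  also have "\<dots> = ring.Span (nichols_algebra n \<xi>) (nichols_scalars n \<xi>) (map ?h us)"
    by (rule Span_nichols_algebra[symmetric]) (simp only: us assms(2))
  finally have span: "carrier (nichols_algebra n \<xi>) = \<dots>" .
  have "set (map ?h us) \<subseteq> carrier (nichols_algebra n \<xi>)"
    unfolding set_map us
    by (rule image_subsetI, rule h.hom_closed, rule subsetD[OF assms(2)])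
  from h.S.Span_finite_dimension[OF nichols_algebra_well_formed(2) this] show ?thesis
    by (subst span)
qed

text \<open>A triangular system of functionals that vanish on the ideal makes a sequence independent modulo it.\<close>

lemma infinite_dimension_nichols_algebra:
  fixes z :: "nat \<Rightarrow> (nat list \<Rightarrow>\<^sub>0 'k)" and \<phi> :: "nat \<Rightarrow> (nat list \<Rightarrow>\<^sub>0 'k) \<Rightarrow> 'k"
  assumes z: "\<And>k. z k \<in> carrier (tensor_algebra n)"
    and \<phi>: "\<And>k a b. \<phi> k (a + b) = \<phi> k a + \<phi> k b" "\<And>k c a. \<phi> k (scale c a) = c * \<phi> k a"
    and N: "\<And>k a. a \<in> nichols_ideal n \<xi> \<Longrightarrow> \<phi> k a = 0"
    and triangular: "\<And>k m. m < k \<Longrightarrow> \<phi> k (z m) = 0" "\<And>k. \<phi> k (z k) \<noteq> 0"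
  shows "\<not> ring.finite_dimension (nichols_algebra n \<xi>) (nichols_scalars n \<xi>) (carrier (nichols_algebra n \<xi>))"
proof
  let ?h = "(+>\<^bsub>tensor_algebra n\<^esub>) (nichols_ideal n \<xi>)"
  let ?us = "\<lambda>k. map z (rev [0..<k])"
  have us: "set (?us k) \<subseteq> carrier (tensor_algebra n)" for k using z by auto
  have indep: "h.S.independent (nichols_scalars n \<xi>) (map ?h (?us k))" for k
  proof (induction k)
    case (Suc k)
    have "?h (z k) \<notin> ?h ` pm.span (set (?us k))"
    proof
      assume "?h (z k) \<in> ?h ` pm.span (set (?us k))"
      then obtain b where b: "b \<in> pm.span (set (?us k))" "?h (z k) = ?h b" by blast
      have "b \<in> carrier (tensor_algebra n)"
        using b(1) pm.span_minimal[OF us subspace_ta] by blast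
      then have "z k - b \<in> nichols_ideal n \<xi>" using b(2) z coset_eq_iff by blast
      then have "\<phi> k (z k - b) = 0" by (rule N)
      moreover have "\<phi> k (z k) = \<phi> k (z k - b) + \<phi> k b" by (simp flip: \<phi>(1))
      moreover have "pm.subspace {a. \<phi> k a = 0}"
        using \<phi>(2)[of k 0 0] by (auto simp: pm.subspace_def \<phi>)
      then have "pm.span (set (?us k)) \<subseteq> {a. \<phi> k a = 0}"
        by (intro pm.span_minimal) (auto simp: triangular)
      ultimately show False using b(1) triangular(2)[of k] by auto
    qed
    then have "?h (z k) \<notin> h.S.Span (nichols_scalars n \<xi>) (map ?h (?us k))"
      unfolding Span_nichols_algebra[OF us] .
    then have "h.S.independent (nichols_scalars n \<xi>) (?h (z k) # map ?h (?us k))"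
      by (rule h.S.independent.li_Cons[OF h.hom_closed[OF z] _ Suc])
    moreover have "map ?h (?us (Suc k)) = ?h (z k) # map ?h (?us k)" by simp
    ultimately show ?case by (simp only:)
  qed simp
  assume "h.S.finite_dimension (nichols_scalars n \<xi>) (carrier (nichols_algebra n \<xi>))"
  then obtain d where d: "h.S.dimension d (nichols_scalars n \<xi>) (carrier (nichols_algebra n \<xi>))"
    unfolding h.S.finite_dimension_def by blast
  have "set (map ?h (?us (Suc d))) \<subseteq> carrier (nichols_algebra n \<xi>)"
    unfolding set_map[of ?h]
    by (rule image_subsetI, rule h.hom_closed, rule subsetD[OF us])
  from h.S.independent_length_le_dimension[OF nichols_algebra_well_formed(2) d indep this]
  show False by simp
qed

end

text \<open>The letters \<open>n - 2, n - 1, 2, 1\<close> add up to \<open>2 n\<close>, so the self-braiding of their iterated commutator is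
  trivial, while none of the three factors of the constant \<open>c\<close> vanishes.\<close>

lemma infinite_dimension_if_gt_4:
  fixes \<xi> :: "'k::field_char_0"
  assumes "n \<ge> 5" "\<xi> ^ n = 1" and prim: "\<forall>m. 0 < m \<and> m < n \<longrightarrow> \<xi> ^ m \<noteq> 1"
  shows "\<not> ring.finite_dimension (nichols_algebra n \<xi>) (nichols_scalars n \<xi>) (carrier (nichols_algebra n \<xi>))"
proof -
  define u where "u = [n - 2, n - 1, 2, 1]"
  define z where "z = braided_ad \<xi> 1 (braided_ad \<xi> 2 (braided_ad \<xi> (n - 1) (word [n - 2])))"
  define c where "c = (1 - \<xi> ^ (n - 3)) * (1 - \<xi>) * (1 - \<xi> ^ 2)"
  have dist: "distinct [n - 2, n - 1, 2, 1]" using assms(1) by auto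
  have pow: "\<xi> ^ (n + m) = \<xi> ^ m" for m using assms(2) by (simp add: power_add)
  have exps: "(n - 1) + (n - 2) = n + (n - 3)" "(n - 1) + (n - 2) + 2 * 2 = n + (n + 1)"
    "(n - 1) + (n - 2) + 2 + 3 * 1 = n + (n + 2)"
    using assms(1) by auto
  have pows: "\<xi> ^ ((n - 1) + (n - 2)) = \<xi> ^ (n - 3)" "\<xi> ^ ((n - 1) + (n - 2) + 2 * 2) = \<xi>"
    "\<xi> ^ ((n - 1) + (n - 2) + 2 + 3 * 1) = \<xi> ^ 2"
    unfolding exps(2,3) unfolding exps(1) pow by simp_all
  have c: "iter_deriv \<xi> u z = scale c 1"
    unfolding u_def z_def iter_deriv_iterated_ad(3)[OF dist] pows c_def by simp
  have "\<xi> ^ (n - 3) \<noteq> 1" "\<xi> ^ 1 \<noteq> 1" "\<xi> ^ 2 \<noteq> 1"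
    by (rule prim[rule_format]; use assms(1) in simp)+
  then have "c \<noteq> 0" by (simp add: c_def)
  have leibniz: "iter_deriv \<xi> u (z ^ Suc k) = scale (of_nat (Suc k) * c) (z ^ k)" for k
    unfolding u_def
  proof (rule iter_deriv_power)
    show "set [n - 1, 2, 1] \<inter> {j. skew_deriv \<xi> j z \<noteq> 0} = {}"
      using iter_deriv_iterated_ad(1)[OF dist, of \<xi>] dist unfolding z_def by fastforce
    show "act \<xi> j z = scale (\<xi> ^ (4 * j)) z" for j
      unfolding z_def by (rule iter_deriv_iterated_ad(2)[OF dist])
    have "4 * (n - 2) + (4 * (n - 1) + (4 * 2 + 4 * 1)) = n * 8" using assms(1) by simp
    then have "\<xi> ^ (4 * (n - 2) + (4 * (n - 1) + (4 * 2 + 4 * 1))) = 1"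
      by (simp only: power_mult assms(2) power_one)
    then show "\<xi> ^ (4 * (n - 2)) * prod_list (map (\<lambda>j. \<xi> ^ (4 * j)) [n - 1, 2, 1]) = 1"
      by (simp only: power_add list.map prod_list.Cons prod_list.Nil mult_1_right)
    show "iter_deriv \<xi> [n - 2, n - 1, 2, 1] z = scale c 1" using c by (simp only: u_def)
  qed
  have u: "u \<noteq> []" by (simp add: u_def)
  have z: "z ^ k \<in> carrier (tensor_algebra n)" for k
    using assms(1)
    by (induction k) (auto simp: z_def ta_one_closed intro!: ta_mult_closed braided_ad_closed word_closed)
  show ?thesis
  proof (rule infinite_dimension_nichols_algebra[where z = "\<lambda>k. z ^ k"
        and \<phi> = "\<lambda>k a. counit (iter_deriv \<xi> (concat (replicate k u)) a)"])
    show "counit (iter_deriv \<xi> (concat (replicate k u)) a) = 0" if "a \<in> nichols_ideal n \<xi>" for k a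
      using that nichols_ideal_eq_deriv_radical[OF assms(2)] by (simp add: deriv_radical_def)
    show "counit (iter_deriv \<xi> (concat (replicate k u)) (z ^ k)) \<noteq> 0" for k
      using \<open>c \<noteq> 0\<close> by (simp add: iter_deriv_powers(2)[OF leibniz u] one_eq_word)
    show "counit (iter_deriv \<xi> (concat (replicate k u)) (z ^ m)) = 0" if "m < k" for k m
      by (simp add: iter_deriv_powers(1)[OF leibniz u that])
  qed (simp_all add: z iter_deriv_linear)
qed

section \<open>Spanning by ordered monomials\<close>

lemma unsorted_split:
  assumes "\<not> sorted u"
  obtains p j i q where "u = p @ j # i # q" "i < j"
proof -
  obtain k where k: "Suc k < length u" "\<not> u ! k \<le> u ! Suc k"
    using assms by (auto simp: sorted_iff_nth_Suc)
  have "u = take k u @ u ! k # u ! Suc k # drop (Suc (Suc k)) u"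
    using k(1) by (metis Cons_nth_drop_Suc Suc_lessD append_take_drop_id)
  then show ?thesis using that k(2) by (meson not_le)
qed

lemma sorted_eq_concat_replicate:
  fixes u :: "nat list"
  assumes "sorted u" "set u \<subseteq> {..<m}"
  shows "u = concat (map (\<lambda>i. replicate (count_list u i) i) [0..<m])"
proof -
  let ?f = "\<lambda>i. replicate (count_list u i) i"
  have "sorted (concat (map ?f [0..<m])) \<and> set (concat (map ?f [0..<m])) \<subseteq> {..<m}"
    by (induction m) (auto simp: sorted_append)
  moreover have "mset u = mset (concat (map ?f [0..<m]))"
  proof (rule multiset_eqI)
    fix c
    have "count (mset (concat (map ?f [0..<m]))) c = (if c < m then count_list u c else 0)"
      by (induction m) auto
    moreover have "count_list u c = 0" if "\<not> c < m"
      using that assms(2) by (auto simp: count_list_0_iff)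
    ultimately show "count (mset u) c = count (mset (concat (map ?f [0..<m]))) c"
      by (simp add: count_mset)
  qed
  ultimately show ?thesis
    using assms(1) by (metis properties_for_sort sorted_sort_id)
qed

text \<open>Straightening: if \<open>g\<^sub>j g\<^sub>i\<close> with \<open>i < j\<close> is, modulo \<open>J\<close>, a combination of products \<open>g\<^sub>a g\<^sub>b\<close> with \<open>a < j\<close>
  and of single generators, then replacing it in a monomial leads to monomials that are shorter or
  lexicographically smaller.  This terminates at the ordered monomials, and those with a high power of
  a generator vanish modulo \<open>J\<close>.\<close>

lemma finite_spanning_set_of_ordered_monomials:
  fixes g :: "nat \<Rightarrow> (nat list \<Rightarrow>\<^sub>0 'k::field)"
  assumes J: "ideal J (tensor_algebra n)"
    and g: "\<And>i. i < m \<Longrightarrow> g i \<in> carrier (tensor_algebra n)"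
    and letters: "\<And>i. i \<in> {1..<n} \<Longrightarrow> word [i] \<in> g ` {..<m}"
    and nilpotent: "\<And>i. i < m \<Longrightarrow> g i ^ N \<in> J"
    and straighten: "\<And>i j. i < j \<Longrightarrow> j < m \<Longrightarrow>
      g j * g i \<in> pm.span ({g a * g b |a b. a < j \<and> b < m} \<union> g ` {..<m} \<union> J)"
  obtains W where "finite W" "W \<subseteq> carrier (tensor_algebra n)"
    "carrier (tensor_algebra n) \<subseteq> pm.span (W \<union> J)"
proof -
  let ?T = "carrier (tensor_algebra n) :: (nat list \<Rightarrow>\<^sub>0 'k) set"
  define W where "W = (\<lambda>es. prod_list (map (\<lambda>i. g i ^ (es ! i)) [0..<m])) ` {es. set es \<subseteq> {..<N} \<and> length es = m}"
  define S where "S = pm.span (W \<union> J)"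
  define mon where "mon u = prod_list (map g u)" for u
  have mon_append: "mon (u @ v) = mon u * mon v" for u v
    by (induction u) (simp_all add: mon_def mult.assoc)
  have S: "pm.subspace S" by (simp add: S_def)
  have JS: "a \<in> S" if "a \<in> J" for a using that by (auto simp: S_def intro: pm.span_base)
  have J_mult: "x * a * y \<in> J" if "a \<in> J" "x \<in> ?T" "y \<in> ?T" for a x y
    using ideal.I_l_closed[OF J that(1,2)] ideal.I_r_closed[OF J _ that(3)] by (simp add: ta_simps(2))
  have g_power: "g i ^ k \<in> ?T" if "i < m" for i k
    using g[OF that] by (induction k) (auto intro: ta_mult_closed ta_one_closed)
  have prod_closed: "prod_list xs \<in> ?T" if "set xs \<subseteq> ?T" for xs
    using that by (induction xs) (auto intro: ta_mult_closed ta_one_closed)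
  have mon_closed: "mon u \<in> ?T" if "set u \<subseteq> {..<m}" for u
    unfolding mon_def using that g by (intro prod_closed) auto
  have normal: "mon u \<in> S" if u: "sorted u" "set u \<subseteq> {..<m}" for u
  proof -
    have power: "mon (replicate k i) = g i ^ k" for k i
      by (induction k) (simp_all add: mon_def)
    have "mon u = mon (concat (map (\<lambda>i. replicate (count_list u i) i) [0..<m]))"
      using sorted_eq_concat_replicate[OF u] by simp
    also have "\<dots> = prod_list (map (\<lambda>i. g i ^ count_list u i) [0..<m])"
    proof -
      have "mon (concat (map (\<lambda>i. replicate (count_list u i) i) xs)) =
          prod_list (map (\<lambda>i. g i ^ count_list u i) xs)" for xs
        by (induction xs) (simp_all add: mon_append power, simp add: mon_def)
      then show ?thesis .
    qed
    finally have eq: "mon u = prod_list (map (\<lambda>i. g i ^ count_list u i) [0..<m])" .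
    show ?thesis
    proof (cases "\<forall>i<m. count_list u i < N")
      case True
      have "mon u \<in> W"
        unfolding W_def eq using True
        by (intro image_eqI[of _ _ "map (count_list u) [0..<m]"] arg_cong[where f = prod_list]) auto
      then show ?thesis by (simp add: S_def pm.span_base)
    next
      case False
      then obtain i where i: "i < m" "N \<le> count_list u i" by (auto simp: not_less)
      have "[0..<m] = [0..<i] @ i # [Suc i..<m]"
        using i(1) upt_add_eq_append[of 0 i "m - i"] by (simp add: upt_conv_Cons)
      moreover have power: "g i ^ count_list u i = g i ^ N * g i ^ (count_list u i - N)"
        using i(2) by (simp flip: power_add)
      ultimately have "mon u = prod_list (map (\<lambda>i. g i ^ count_list u i) [0..<i]) * g i ^ N *
          (g i ^ (count_list u i - N) * prod_list (map (\<lambda>i. g i ^ count_list u i) [Suc i..<m]))"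
        unfolding eq by (simp add: power mult.assoc)
      also have "\<dots> \<in> J"
        using i(1) g_power
        by (intro J_mult[OF nilpotent] ta_mult_closed prod_closed) auto
      finally show ?thesis by (rule JS)
    qed
  qed
  have words: "mon u \<in> S" if "set u \<subseteq> {..<m}" for u
    using wf_lenlex[OF wf_less_than] that
  proof (induction u rule: wf_induct_rule)
    case (less u)
    show ?case
    proof (cases "sorted u")
      case True
      then show ?thesis using normal less.prems by blast
    next
      case False
      then obtain p j i q where u: "u = p @ j # i # q" "i < j" by (rule unsorted_split)
      have pq: "set p \<subseteq> {..<m}" "set q \<subseteq> {..<m}" "j < m" using less.prems u(1) by auto
      let ?X = "{x. mon p * x * mon q \<in> S}"
      have "{g a * g b |a b. a < j \<and> b < m} \<union> g ` {..<m} \<union> J \<subseteq> ?X"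
      proof (intro Un_least subsetI)
        fix x assume "x \<in> {g a * g b |a b. a < j \<and> b < m}"
        then obtain a b where ab: "x = g a * g b" "a < j" "b < m" by blast
        have "(p @ a # b # q, u) \<in> lenlex less_than"
          unfolding u(1) lenlex_conv lex_conv using ab(2) by auto
        then have "mon (p @ a # b # q) \<in> S" using ab pq by (intro less.IH) auto
        then show "x \<in> ?X" by (simp add: mon_append ab(1)) (simp add: mon_def mult.assoc)
      next
        fix x assume "x \<in> g ` {..<m}"
        then obtain a where a: "x = g a" "a < m" by blast
        have "(p @ a # q, u) \<in> lenlex less_than"
          unfolding u(1) lenlex_conv by auto
        then have "mon (p @ a # q) \<in> S" using a pq by (intro less.IH) auto
        then show "x \<in> ?X" by (simp add: mon_append a(1)) (simp add: mon_def mult.assoc)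
      next
        fix x assume "x \<in> J"
        then show "x \<in> ?X" using J_mult mon_closed pq JS by simp
      qed
      moreover have "pm.subspace ?X"
        using S by (simp add: pm.subspace_def distrib_left distrib_right scale_mult)
      ultimately have "g j * g i \<in> ?X"
        using straighten[OF u(2) pq(3)] pm.span_minimal by blast
      then show ?thesis unfolding u(1) mon_append by (simp add: mon_def mult.assoc)
    qed
  qed
  have "word w \<in> S" if "w \<in> lists {1..<n}" for w
  proof -
    have "\<exists>u. set u \<subseteq> {..<m} \<and> word w = mon u"
      using that
    proof (induction w)
      case Nil
      show ?case by (rule exI[of _ "[]"]) (simp add: mon_def one_eq_word)
    next
      case (Cons i w)
      obtain u where u: "set u \<subseteq> {..<m}" "word w = mon u" using Cons by blast
      obtain k where k: "k < m" "word [i] = g k" using letters[of i] Cons by auto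
      have "word (i # w) = g k * mon u"
        by (simp add: word_mult flip: u(2) k(2))
      then show ?case using u k by (intro exI[of _ "k # u"]) (simp add: mon_def)
    qed
    then show ?thesis using words by auto
  qed
  then have "a \<in> S" if "a \<in> ?T" for a
    using that pm.subspace_sum[OF S, of "Poly_Mapping.keys a"] lin_ext_word_self[of a]
    by (metis (no_types, lifting) lin_ext_def mem_Collect_eq pm.subspace_scale[OF S] subsetD ta_simps(1))
  moreover have "finite W"
    unfolding W_def by (intro finite_imageI finite_lists_length_eq) simp
  moreover have "W \<subseteq> ?T"
    unfolding W_def using g_power by (auto intro!: prod_closed)
  ultimately show ?thesis using that unfolding S_def by blast
qed

section \<open>Relations of the Nichols algebra\<close>

lemma letter_closed: "i \<in> {1..<n} \<Longrightarrow> word [i] \<in> carrier (tensor_algebra n)"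
  by (rule word_closed) simp

lemma counit_mult: "counit (a * b) = counit a * counit b"
proof (induction a rule: word_induct)
  case (word u)
  show ?case
    by (induction b rule: word_induct) (simp_all add: word_mult distrib_left scale_mult)
qed (simp_all add: distrib_right scale_mult)

context
  fixes n :: nat and \<xi> :: "'k::field"
  assumes root: "\<xi> ^ n = 1"
begin

lemma skew_deriv_letter_power:
  "skew_deriv \<xi> j (word [i] ^ k) = (if i = j then scale (\<Sum>t<k. \<xi> ^ (i * t)) (word [i] ^ (k - 1)) else 0)"
proof (induction k)
  case (Suc k)
  have "word [i] * word [i] ^ (k - Suc 0) = word [i] ^ k" if "k > 0"
    using that by (simp flip: power_Suc)
  moreover have "act \<xi> j (word [i] ^ k) = scale (\<xi> ^ (j * k)) (word [i] ^ k)"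
    using act_power[of \<xi> j "word [i]" "\<xi> ^ j" k] by (simp add: act_word power_mult)
  ultimately show ?case
    unfolding power_Suc skew_deriv_mult skew_deriv_letter Suc
    by (cases "k = 0") (auto simp: scale_mult pm.scale_left_distrib)
qed (simp add: skew_deriv_one)

text \<open>The self-braiding \<open>\<xi>\<^sup>i\<close> of \<open>s\<^sub>i\<close> is a nontrivial root of unity of order dividing \<open>n\<close>, so the quantum integer
  \<open>1 + \<xi>\<^sup>i + \<dots> + \<xi>\<^bsup>i (n - 1)\<^esup>\<close> is zero.\<close>

lemma letter_power_in_deriv_radical:
  assumes "i \<in> {1..<n}" "\<xi> ^ i \<noteq> 1"
  shows "word [i] ^ n \<in> deriv_radical n \<xi>"
proof (rule deriv_radicalI)
  have "(\<Sum>t<n. \<xi> ^ (i * t)) = 0"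
    using assms(2) root geometric_sum[of "\<xi> ^ i" n]
    by (simp add: power_mult[symmetric] mult.commute[of n]) (simp add: power_mult mult.commute[of i n])
  then show "skew_deriv \<xi> j (word [i] ^ n) \<in> deriv_radical n \<xi>" for j
    by (auto simp: skew_deriv_letter_power pm.subspace_0[OF subspace_deriv_radical])
  show "word [i] ^ n \<in> carrier (tensor_algebra n)"
  proof -
    have "word [i] ^ k \<in> carrier (tensor_algebra n)" for k
      by (induction k) (simp_all add: ta_one_closed ta_mult_closed letter_closed[OF assms(1)])
    then show ?thesis .
  qed
  show "counit (word [i] ^ n) = 0"
    using assms(1) by (cases n) (simp_all add: counit_mult)
qed

text \<open>Letters whose double braiding is trivial commute up to a scalar.\<close>

lemma braided_ad_in_deriv_radical:
  assumes "i \<in> {1..<n}" "j \<in> {1..<n}" "\<xi> ^ (i + j) = 1"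
  shows "braided_ad \<xi> i (word [j]) \<in> deriv_radical n \<xi>"
proof (rule deriv_radicalI)
  show "skew_deriv \<xi> m (braided_ad \<xi> i (word [j])) \<in> deriv_radical n \<xi>" for m
    using assms(3)
    by (auto simp: skew_deriv_braided_ad skew_deriv_letter act_one act_zero
        pm.subspace_0[OF subspace_deriv_radical])
qed (use braided_ad_closed[OF letter_closed[OF assms(2)] assms(1)] in
  \<open>simp_all add: braided_ad_def counit_mult\<close>)

text \<open>The quantum Serre relation: \<open>\<partial>\<^sub>j\<close> maps it to \<open>(1 - \<xi>\<^bsup>i+j\<^esup>) (1 - \<xi>\<^bsup>2i+j\<^esup>) s\<^sub>i\<^sup>2\<close>.\<close>

lemma serre_in_deriv_radical:
  assumes "i \<in> {1..<n}" "j \<in> {1..<n}" "\<xi> ^ (2 * i + j) = 1"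
  shows "braided_ad \<xi> i (braided_ad \<xi> i (word [j])) \<in> deriv_radical n \<xi>"
proof (rule deriv_radicalI)
  show "skew_deriv \<xi> m (braided_ad \<xi> i (braided_ad \<xi> i (word [j]))) \<in> deriv_radical n \<xi>" for m
  proof (cases "m = j")
    case True
    have "skew_deriv \<xi> j (braided_ad \<xi> i (word [j])) = scale (1 - \<xi> ^ (i + j)) (word [i])"
      by (simp add: skew_deriv_braided_ad skew_deriv_letter act_one pm.scale_left_diff_distrib)
    moreover have "\<xi> ^ i * \<xi> ^ (i + j) = 1" using assms(3) by (simp add: mult_2 add_ac flip: power_add)
    ultimately have "skew_deriv \<xi> j (braided_ad \<xi> i (braided_ad \<xi> i (word [j]))) = 0"
      unfolding skew_deriv_braided_ad[of \<xi> j i "braided_ad \<xi> i (word [j])"]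
      by (simp add: act_scale act_word scale_mult mult.commute mult.left_commute)
    then show ?thesis by (simp add: True pm.subspace_0[OF subspace_deriv_radical])
  next
    case False
    then show ?thesis
      by (simp add: skew_deriv_braided_ad skew_deriv_letter act_zero pm.subspace_0[OF subspace_deriv_radical])
  qed
qed (use braided_ad_closed[OF braided_ad_closed[OF letter_closed[OF assms(2)] assms(1)] assms(1)] in
  \<open>simp_all add: braided_ad_def counit_mult\<close>)

end

section \<open>Root vectors for \<open>n = 4\<close>\<close>

context
  fixes \<xi> :: "'k::field_char_0"
  assumes i_sq: "\<xi> * \<xi> = - 1"
begin

private abbreviation "J \<equiv> deriv_radical 4 \<xi>"
private abbreviation "TA \<equiv> carrier (tensor_algebra 4) :: (nat list \<Rightarrow>\<^sub>0 'k) set"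

text \<open>Root vectors for \<open>\<alpha>\<^sub>1\<close>, \<open>\<alpha>\<^sub>2\<close>, \<open>\<alpha>\<^sub>3\<close>, \<open>\<alpha>\<^sub>1 + \<alpha>\<^sub>2\<close>, \<open>\<alpha>\<^sub>2 + \<alpha>\<^sub>3\<close> and \<open>\<alpha>\<^sub>1 + \<alpha>\<^sub>2 + \<alpha>\<^sub>3\<close>.  The last three are
  braided commutators \<open>ad x y\<close>, \<open>ad z y\<close> and \<open>ad x (ad z y)\<close> with the powers of \<open>\<xi>\<close> evaluated.\<close>

private definition x :: "nat list \<Rightarrow>\<^sub>0 'k" where "x = word [1]"
private definition y :: "nat list \<Rightarrow>\<^sub>0 'k" where "y = word [2]"
private definition z :: "nat list \<Rightarrow>\<^sub>0 'k" where "z = word [3]"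
private definition yx :: "nat list \<Rightarrow>\<^sub>0 'k" where "yx = x * y - scale \<xi> (y * x)"
private definition yz :: "nat list \<Rightarrow>\<^sub>0 'k" where "yz = z * y + scale \<xi> (y * z)"
private definition yxz :: "nat list \<Rightarrow>\<^sub>0 'k" where "yxz = x * yz + yz * x"

private lemma xi_powers: "\<xi> ^ 2 = - 1" "\<xi> ^ 3 = - \<xi>" "\<xi> ^ 4 = 1" "\<xi> ^ 5 = \<xi>" "\<xi> ^ 6 = -1" "\<xi> ^ 8 = 1"
  using i_sq by (simp_all add: numeral_eq_Suc mult.assoc[symmetric])

private lemma xi_ne: "\<xi> \<noteq> 1" "\<xi> \<noteq> - 1"
  using i_sq by auto

private lemma xi_mult: "\<xi> * (\<xi> * c) = - c"
  using i_sq by (simp flip: mult.assoc)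

text \<open>These rules expand an expression into the form \<open>\<Sum> \<plusminus> w + \<Sum> \<plusminus> \<xi> w'\<close> with noncommutative monomials
  \<open>w\<close>, \<open>w'\<close>, so that identities in the free algebra are proved by cancellation.\<close>

private lemmas expand = ring_distribs mult.assoc scale_mult pm.scale_right_distrib pm.scale_right_diff_distrib
  i_sq xi_mult

private lemma carriers: "x \<in> TA" "y \<in> TA" "z \<in> TA" "yx \<in> TA" "yz \<in> TA" "yxz \<in> TA"
proof -
  show *: "x \<in> TA" "y \<in> TA" "z \<in> TA" by (simp_all add: x_def y_def z_def letter_closed)
  show "yx \<in> TA" "yz \<in> TA"
    unfolding yx_def yz_def
    by (intro pm.subspace_add[OF subspace_ta] pm.subspace_diff[OF subspace_ta] pm.subspace_scale[OF subspace_ta]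
        ta_mult_closed *)+
  then show "yxz \<in> TA"
    unfolding yxz_def by (intro pm.subspace_add[OF subspace_ta] ta_mult_closed *)
qed

private lemma J_closed:
  "a \<in> J \<Longrightarrow> b \<in> J \<Longrightarrow> a + b \<in> J" "a \<in> J \<Longrightarrow> b \<in> J \<Longrightarrow> a - b \<in> J" "a \<in> J \<Longrightarrow> - a \<in> J"
  "a \<in> J \<Longrightarrow> scale c a \<in> J" "a \<in> J \<Longrightarrow> t \<in> TA \<Longrightarrow> t * a \<in> J" "a \<in> J \<Longrightarrow> t \<in> TA \<Longrightarrow> a * t \<in> J"
  using subspace_deriv_radical[of 4 \<xi>] ideal.I_l_closed[OF ideal_deriv_radical[of 4 \<xi>]]
    ideal.I_r_closed[OF ideal_deriv_radical[of 4 \<xi>]]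
  by (simp_all add: pm.subspace_add pm.subspace_diff pm.subspace_neg pm.subspace_scale ta_simps(2))

private lemmas in_J = J_closed carriers

private lemma J_cancel: "a + scale \<xi> a \<in> J \<Longrightarrow> a \<in> J"
proof -
  assume a: "a + scale \<xi> a \<in> J"
  have "1 + \<xi> \<noteq> 0"
    using xi_ne(2) by (simp add: eq_neg_iff_add_eq_0 add.commute)
  moreover have "a + scale \<xi> a = scale (1 + \<xi>) a"
    by (simp add: pm.scale_left_distrib)
  ultimately show ?thesis using J_closed(4)[OF a, of "1 / (1 + \<xi>)"] by simp
qed

private lemma x_z_relation: "x * z - scale \<xi> (z * x) \<in> J"
  using braided_ad_in_deriv_radical[of \<xi> 4 1 3]
  by (simp add: braided_ad_def act_word xi_powers x_def z_def scale_mult)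

private lemma ad_letters:
  "braided_ad \<xi> 1 (word [2]) = yx" "braided_ad \<xi> 3 (word [2]) = yz"
  "act \<xi> m x = scale (\<xi> ^ m) x" "act \<xi> m y = scale (\<xi> ^ m) y" "act \<xi> m z = scale (\<xi> ^ m) z"
  by (simp_all add: braided_ad_def act_word xi_powers x_def y_def z_def yx_def yz_def scale_mult)

private lemma act_y:
  "act \<xi> m yx = scale (\<xi> ^ (2 * m)) yx" "act \<xi> m yz = scale (\<xi> ^ (2 * m)) yz"
  by (simp_all add: yx_def yz_def act_diff act_add act_scale act_mult ad_letters scale_mult
      pm.scale_right_diff_distrib pm.scale_right_distrib power_add mult_2 mult_2_right mult_ac)

private lemma serre_x: "x * yx + yx * x \<in> J"
proof -
  have "braided_ad \<xi> 1 (braided_ad \<xi> 1 (word [2])) \<in> J"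
    by (rule serre_in_deriv_radical) (simp_all add: xi_powers)
  moreover have "braided_ad \<xi> 1 yx = x * yx + yx * x"
    by (simp add: braided_ad_def act_y xi_powers x_def)
  ultimately show ?thesis by (simp only: ad_letters)
qed

private lemma serre_z: "z * yz + yz * z \<in> J"
proof -
  have "braided_ad \<xi> 3 (braided_ad \<xi> 3 (word [2])) \<in> J"
    by (rule serre_in_deriv_radical) (simp_all add: xi_powers)
  moreover have "braided_ad \<xi> 3 yz = z * yz + yz * z"
    by (simp add: braided_ad_def act_y xi_powers z_def)
  ultimately show ?thesis by (simp only: ad_letters)
qed

private lemma y_square: "y * y \<in> J"
proof (rule deriv_radicalI)
  show "skew_deriv \<xi> j (y * y) \<in> J" for j
    by (auto simp: y_def skew_deriv_mult skew_deriv_letter act_word xi_powers pm.subspace_0[OF subspace_deriv_radical])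
qed (simp_all add: y_def counit_mult letter_closed ta_mult_closed)

private lemma deriv_y:
  "skew_deriv \<xi> j yx = (if j = 2 then x + scale \<xi> x else 0)"
  "skew_deriv \<xi> j yz = (if j = 2 then z - scale \<xi> z else 0)"
  unfolding ad_letters(1,2)[symmetric]
  by (auto simp: skew_deriv_braided_ad skew_deriv_letter act_one act_zero xi_powers x_def z_def)

text \<open>This relation of degree \<open>\<alpha>\<^sub>1 + 2 \<alpha>\<^sub>2 + \<alpha>\<^sub>3\<close> is the one that is special to super type.  The derivations
  \<open>\<partial>\<^sub>1\<close> and \<open>\<partial>\<^sub>3\<close> kill it, and \<open>\<partial>\<^sub>2\<close> maps it to a multiple of the commutator of \<open>y\<close> with the
  relation between \<open>x\<close> and \<open>z\<close>.\<close>

private lemma yx_yz_relation: "yx * yz + yz * yx \<in> J"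
proof (rule deriv_radicalI)
  let ?C = "x * z - scale \<xi> (z * x)"
  show "skew_deriv \<xi> j (yx * yz + yz * yx) \<in> J" for j
  proof (cases "j = 2")
    case True
    have "skew_deriv \<xi> 2 (yx * yz + yz * yx) =
        ?C * y - y * ?C + scale \<xi> (?C * y - y * ?C)"
      by (simp add: skew_deriv_linear skew_deriv_mult deriv_y act_y xi_powers)
        (simp add: yx_def yz_def expand)
    also have "\<dots> \<in> J" by (intro in_J x_z_relation)
    finally show ?thesis by (simp add: True)
  qed (simp add: skew_deriv_linear skew_deriv_mult deriv_y pm.subspace_0[OF subspace_deriv_radical])
  show "yx * yz + yz * yx \<in> TA"
    by (intro pm.subspace_add[OF subspace_ta] ta_mult_closed carriers)
  show "counit (yx * yz + yz * yx) = 0"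
    by (simp add: counit_mult yx_def y_def)
qed

text \<open>From here on no derivations are used: each relation is an explicit combination of earlier ones in the
  free algebra.  The combination is found by straightening the product of a generator with an earlier
  relation; here that product is the relation between \<open>x\<close> and \<open>z\<close> times \<open>y\<close>.\<close>

private lemma z_yx_relation: "z * yx + scale \<xi> yxz + yx * z \<in> J" (is "?A \<in> J")
proof -
  let ?C = "x * z - scale \<xi> (z * x)"
  have "?A = scale \<xi> (?C * y - y * ?C)"
    by (simp add: yx_def yz_def yxz_def expand)
  also have "\<dots> \<in> J" by (intro in_J x_z_relation)
  finally show ?thesis .
qed

private lemma x_yxz_relation: "x * yxz + scale \<xi> (yxz * x) \<in> J" (is "?B \<in> J")
proof -
  let ?C = "x * z - scale \<xi> (z * x)" and ?S = "x * yx + yx * x" and ?A = "z * yx + scale \<xi> yxz + yx * z"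
  have "?B = ?A * x - scale \<xi> (x * ?A) - z * ?S + scale \<xi> (?C * yx + ?S * z - yx * ?C)"
    by (simp add: expand)
  also have "\<dots> \<in> J" by (intro in_J x_z_relation serre_x z_yx_relation)
  finally show ?thesis .
qed

private lemma z_yxz_relation: "z * yxz - scale \<xi> (yxz * z) \<in> J" (is "?B \<in> J")
proof -
  let ?C = "x * z - scale \<xi> (z * x)" and ?S = "z * yz + yz * z"
  have "?B = scale \<xi> (?C * yz - x * ?S - yz * ?C) + ?S * x"
    by (simp add: yxz_def expand)
  also have "\<dots> \<in> J" by (intro in_J x_z_relation serre_z)
  finally show ?thesis .
qed

private lemma yx_y_relation: "yx * y + scale \<xi> (y * yx) \<in> J" (is "?R \<in> J")
proof -
  have "?R = x * (y * y) + y * y * x" by (simp add: yx_def expand)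
  also have "\<dots> \<in> J" by (intro in_J y_square)
  finally show ?thesis .
qed

private lemma yz_y_relation: "yz * y - scale \<xi> (y * yz) \<in> J" (is "?R \<in> J")
proof -
  have "?R = z * (y * y) + y * y * z" by (simp add: yz_def expand)
  also have "\<dots> \<in> J" by (intro in_J y_square)
  finally show ?thesis .
qed

private lemma yx_square: "yx * yx \<in> J"
proof (rule J_cancel)
  let ?R = "yx * y + scale \<xi> (y * yx)" and ?S = "x * yx + yx * x"
  have "yx * yx + scale \<xi> (yx * yx) = - scale \<xi> (x * ?R + scale \<xi> (?R * x) - ?S * y + y * ?S)"
    by (simp add: yx_def expand)
  also have "\<dots> \<in> J" by (intro in_J yx_y_relation serre_x)
  finally show "yx * yx + scale \<xi> (yx * yx) \<in> J" .
qed

private lemma yz_square: "yz * yz \<in> J"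
proof (rule J_cancel)
  let ?R = "yz * y - scale \<xi> (y * yz)" and ?S = "z * yz + yz * z"
  have "yz * yz + scale \<xi> (yz * yz) = scale \<xi> (?R * z) - z * ?R + ?S * y - y * ?S"
    by (simp add: yz_def expand)
  also have "\<dots> \<in> J" by (intro in_J yz_y_relation serre_z)
  finally show "yz * yz + scale \<xi> (yz * yz) \<in> J" .
qed

private lemma yxz_y_relation: "yxz * y + y * yxz - yz * yx - scale \<xi> (yx * yz) \<in> J" (is "?Q \<in> J")
proof -
  let ?R = "yz * y - scale \<xi> (y * yz)"
  have "?Q = x * ?R + scale \<xi> (?R * x)" by (simp add: yx_def yxz_def expand)
  also have "\<dots> \<in> J" by (intro in_J yz_y_relation)
  finally show ?thesis .
qed

private lemma yxz_yx_relation: "yxz * yx - yx * yxz \<in> J" (is "?E \<in> J")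
proof -
  let ?P = "yx * yz + yz * yx" and ?S = "x * yx + yx * x"
  have "?E = x * ?P - ?P * x - ?S * yz + yz * ?S" by (simp add: yxz_def expand)
  also have "\<dots> \<in> J" by (intro in_J yx_yz_relation serre_x)
  finally show ?thesis .
qed

private lemma yxz_yz_relation: "yxz * yz - yz * yxz \<in> J" (is "?E \<in> J")
proof -
  let ?P = "yx * yz + yz * yx" and ?S = "z * yz + yz * z" and ?A = "z * yx + scale \<xi> yxz + yx * z"
  have "?E = - scale \<xi> (?A * yz - yz * ?A - yx * ?S + ?S * yx + ?P * z - z * ?P)"
    by (simp add: expand)
  also have "\<dots> \<in> J" by (intro in_J z_yx_relation yx_yz_relation serre_z)
  finally show ?thesis .
qed

private lemma yxz_square: "yxz * yxz \<in> J"
proof (rule J_cancel)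
  let ?B = "x * yxz + scale \<xi> (yxz * x)" and ?E = "yxz * yz - yz * yxz"
  have "yxz * yxz + scale \<xi> (yxz * yxz) = ?B * yz + yz * ?B + scale \<xi> (?E * x) - x * ?E"
    by (simp add: yxz_def expand)
  also have "\<dots> \<in> J" by (intro in_J x_yxz_relation yxz_yz_relation)
  finally show "yxz * yxz + scale \<xi> (yxz * yxz) \<in> J" .
qed

text \<open>The generators are ordered so that \<open>x\<close> and \<open>z\<close> come last.  Moving one of them to the right through the other
  generators then only creates generators, never longer products, and the four generators that
  contain \<open>y\<close> satisfy quadratic relations among themselves.\<close>

lemma finite_spanning_set_4:
  obtains W where "finite W" "W \<subseteq> carrier (tensor_algebra 4)"
    "carrier (tensor_algebra 4) \<subseteq> pm.span (W \<union> deriv_radical 4 \<xi>)"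
proof -
  define g where "g = (!) [y, yx, yz, yxz, x, z]"
  have g: "g 0 = y" "g 1 = yx" "g (Suc 0) = yx" "g 2 = yz" "g 3 = yxz" "g 4 = x" "g 5 = z"
    by (simp_all add: g_def)
  have less_6: "i < 6 \<longleftrightarrow> i = 0 \<or> i = 1 \<or> i = 2 \<or> i = 3 \<or> i = 4 \<or> i = 5" for i :: nat
    by auto
  define B where "B j = pm.span ({g a * g b |a b. a < j \<and> b < 6} \<union> g ` {..<6} \<union> J)" for j :: nat
  have B: "g a * g b \<in> B j" if "a < j" "b < 6" for a b j
    unfolding B_def using that by (blast intro: pm.span_base)
  have B1: "g a \<in> B j" if "a < 6" for a j
    unfolding B_def using that by (intro pm.span_base) simp
  have BJ: "r \<in> B j" if "r \<in> J" for r j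
    unfolding B_def using that by (intro pm.span_base) simp
  have sub: "a \<in> B j \<Longrightarrow> b \<in> B j \<Longrightarrow> a + b \<in> B j" "a \<in> B j \<Longrightarrow> b \<in> B j \<Longrightarrow> a - b \<in> B j"
    "a \<in> B j \<Longrightarrow> - a \<in> B j" "a \<in> B j \<Longrightarrow> scale c a \<in> B j" for a b c j
    by (simp_all add: B_def pm.span_add pm.span_diff pm.span_neg pm.span_scale)
  have relation: "g j * g i \<in> B j" if "t \<in> B j" "g j * g i - t \<in> J" for i j t
    using sub(1)[OF that(1) BJ[OF that(2)]] by simp
  note span_rules = sub B B1
  \<comment> \<open>The straightening rule for each unordered pair; the term given to \<open>relation\<close> is what replaces the
    product modulo the radical.\<close>
  have r10: "g 1 * g 0 \<in> B 1"
    by (rule relation[of "- scale \<xi> (g 0 * g 1)"]) ((intro span_rules; simp), use yx_y_relation in \<open>simp add: g\<close>)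
  have r20: "g 2 * g 0 \<in> B 2"
    by (rule relation[of "scale \<xi> (g 0 * g 2)"]) ((intro span_rules; simp), use yz_y_relation in \<open>simp add: g\<close>)
  have r30: "g 3 * g 0 \<in> B 3"
    by (rule relation[of "g 2 * g 1 + scale \<xi> (g 1 * g 2) - g 0 * g 3"])
      ((intro span_rules; simp), use yxz_y_relation in \<open>simp add: g algebra_simps\<close>)
  have r40: "g 4 * g 0 \<in> B 4"
    by (rule relation[of "g 1 + scale \<xi> (g 0 * g 4)"])
      ((intro span_rules; simp), simp add: g yx_def pm.subspace_0[OF subspace_deriv_radical])
  have r50: "g 5 * g 0 \<in> B 5"
    by (rule relation[of "g 2 - scale \<xi> (g 0 * g 5)"])
      ((intro span_rules; simp), simp add: g yz_def pm.subspace_0[OF subspace_deriv_radical])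
  have r21: "g 2 * g 1 \<in> B 2"
    by (rule relation[of "- (g 1 * g 2)"]) ((intro span_rules; simp), use yx_yz_relation in \<open>simp add: g algebra_simps\<close>)
  have r31: "g 3 * g 1 \<in> B 3"
    by (rule relation[of "g 1 * g 3"]) ((intro span_rules; simp), use yxz_yx_relation in \<open>simp add: g\<close>)
  have r41: "g 4 * g 1 \<in> B 4"
    by (rule relation[of "- (g 1 * g 4)"]) ((intro span_rules; simp), use serre_x in \<open>simp add: g\<close>)
  have r51: "g 5 * g 1 \<in> B 5"
    by (rule relation[of "- scale \<xi> (g 3) - g 1 * g 5"])
      ((intro span_rules; simp), use z_yx_relation in \<open>simp add: g algebra_simps\<close>)
  have r32: "g 3 * g 2 \<in> B 3"
    by (rule relation[of "g 2 * g 3"]) ((intro span_rules; simp), use yxz_yz_relation in \<open>simp add: g\<close>)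
  have r42: "g 4 * g 2 \<in> B 4"
    by (rule relation[of "g 3 - g 2 * g 4"])
      ((intro span_rules; simp), simp add: g yxz_def pm.subspace_0[OF subspace_deriv_radical])
  have r52: "g 5 * g 2 \<in> B 5"
    by (rule relation[of "- (g 2 * g 5)"]) ((intro span_rules; simp), use serre_z in \<open>simp add: g\<close>)
  have r43: "g 4 * g 3 \<in> B 4"
    by (rule relation[of "- scale \<xi> (g 3 * g 4)"]) ((intro span_rules; simp), use x_yxz_relation in \<open>simp add: g\<close>)
  have r53: "g 5 * g 3 \<in> B 5"
    by (rule relation[of "scale \<xi> (g 3 * g 5)"]) ((intro span_rules; simp), use z_yxz_relation in \<open>simp add: g\<close>)
  have r54: "g 5 * g 4 \<in> B 5"
    by (rule relation[of "- scale \<xi> (g 4 * g 5)"])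
      ((intro span_rules; simp), use J_closed(4)[OF x_z_relation, of \<xi>] in \<open>simp add: g expand add.commute\<close>)
  have squares: "a ^ 4 \<in> J" if "a * a \<in> J" "a \<in> TA" for a
    using J_closed(5)[OF that(1) ta_mult_closed[OF that(2,2)]] by (simp add: numeral_eq_Suc mult.assoc)
  have "x ^ 4 \<in> J" "z ^ 4 \<in> J"
    unfolding x_def z_def using xi_ne
    by (auto intro!: letter_power_in_deriv_radical simp: xi_powers minus_equation_iff[of \<xi>])
  show ?thesis
  proof (rule finite_spanning_set_of_ordered_monomials[of J 4 6 g 4])
    show "ideal J (tensor_algebra 4)" by (rule ideal_deriv_radical)
    show "g i \<in> TA" if "i < 6" for i
      using that carriers unfolding less_6 by (auto simp: g)
    show "word [i] \<in> g ` {..<6}" if "i \<in> {1..<4}" for i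
    proof -
      have "i = 1 \<or> i = 2 \<or> i = 3" using that by auto
      moreover have "x = g 4" "y = g 0" "z = g 5" by (simp_all add: g)
      ultimately show ?thesis by (auto simp: x_def y_def z_def)
    qed
    show "g i ^ 4 \<in> J" if "i < 6" for i
      using that \<open>x ^ 4 \<in> J\<close> \<open>z ^ 4 \<in> J\<close> squares[OF y_square] squares[OF yx_square] squares[OF yz_square] squares[OF yxz_square] carriers
      unfolding less_6 by (auto simp: g)
    show "g j * g i \<in> pm.span ({g a * g b |a b. a < j \<and> b < 6} \<union> g ` {..<6} \<union> J)"
      if "i < j" "j < 6" for i j
    proof -
      have "g j * g i \<in> B j"
        using that less_6[of i] less_6[of j] r10 r20 r30 r40 r50 r21 r31 r41 r51 r32 r42 r52 r43 r53 r54
        by auto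
      then show ?thesis by (simp only: B_def)
    qed
  qed (use that in blast)
qed

end

lemma finite_spanning_set_le_4:
  fixes \<xi> :: "'k::field_char_0"
  assumes "2 \<le> n" "n \<le> 4" "\<xi> ^ n = 1" and prim: "\<forall>m. 0 < m \<and> m < n \<longrightarrow> \<xi> ^ m \<noteq> 1"
  obtains W where "finite W" "W \<subseteq> carrier (tensor_algebra n)"
    "carrier (tensor_algebra n) \<subseteq> pm.span (W \<union> deriv_radical n \<xi>)"
proof -
  have power: "word [i] ^ n \<in> deriv_radical n \<xi>" if "i \<in> {1..<n}" for i
    using that prim by (intro letter_power_in_deriv_radical[OF assms(3)]) auto
  consider "n = 2" | "n = 3" | "n = 4" using assms(1,2) by linarith
  then show ?thesis
  proof cases
    case 1
    show ?thesis
    proof (rule finite_spanning_set_of_ordered_monomials[of "deriv_radical n \<xi>" n 1 "\<lambda>_. word [1]" n])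
      show "word [1] ^ n \<in> deriv_radical n \<xi>" by (rule power) (simp add: 1)
      show "word [1] \<in> carrier (tensor_algebra n)" by (rule letter_closed) (simp add: 1)
      show "word [i] \<in> (\<lambda>_. word [1]) ` {..<1::nat}" if "i \<in> {1..<n}" for i
      proof -
        have "i = 1" using that by (simp add: 1)
        then show ?thesis by auto
      qed
    qed (use that ideal_deriv_radical in auto)
  next
    case 2
    have "braided_ad \<xi> 1 (word [2]) \<in> deriv_radical n \<xi>"
      using assms(3) by (intro braided_ad_in_deriv_radical) (simp_all add: 2 numeral_eq_Suc)
    then have ad: "word [1] * word [2] - scale \<xi> (word [2] * word [1]) \<in> deriv_radical n \<xi>"
      by (simp add: braided_ad_def act_word scale_mult)
    have nz: "\<xi> \<noteq> 0" using assms(3) by (auto simp: 2)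
    let ?g = "\<lambda>i. word [Suc i] :: nat list \<Rightarrow>\<^sub>0 'k"
    show ?thesis
    proof (rule finite_spanning_set_of_ordered_monomials[of "deriv_radical n \<xi>" n 2 ?g n])
      show "?g i \<in> carrier (tensor_algebra n)" if "i < 2" for i
        using that by (intro letter_closed) (auto simp: 2)
      show "?g i ^ n \<in> deriv_radical n \<xi>" if "i < 2" for i
        using that by (intro power) (auto simp: 2)
      show "word [i] \<in> ?g ` {..<2}" if "i \<in> {1..<n}" for i
        using that by (intro image_eqI[of _ _ "i - 1"]) (auto simp: 2)
      show "?g j * ?g i \<in> pm.span ({?g a * ?g b |a b. a < j \<and> b < 2} \<union> ?g ` {..<2} \<union> deriv_radical n \<xi>)"
        (is "_ \<in> pm.span ?A") if "i < j" "j < 2" for i j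
      proof -
        have ij: "i = 0" "j = 1" using that by auto
        have 01: "?g 0 * ?g 1 \<in> pm.span ?A"
          unfolding ij by (intro pm.span_base UnI1 CollectI, rule exI[of _ 0], rule exI[of _ 1], simp)
        have rel: "?g 0 * ?g 1 - scale \<xi> (?g 1 * ?g 0) \<in> pm.span ?A"
          using ad by (intro pm.span_base UnI2) (simp add: numeral_2_eq_2)
        have eq: "?g 1 * ?g 0 =
            scale (inverse \<xi>) (?g 0 * ?g 1 - (?g 0 * ?g 1 - scale \<xi> (?g 1 * ?g 0)))"
          using nz by simp
        have "?g 1 * ?g 0 \<in> pm.span ?A"
          by (subst eq) (intro pm.span_scale pm.span_diff 01 rel)
        then show ?thesis by (simp only: ij)
      qed
    qed (use that ideal_deriv_radical in auto)
  next
    case 3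
    have "(\<xi> ^ 2 - 1) * (\<xi> ^ 2 + 1) = 0"
      using assms(3) by (simp add: 3 algebra_simps flip: power_add)
    moreover have "\<xi> ^ 2 \<noteq> 1" using prim by (simp add: 3)
    ultimately have "\<xi> * \<xi> = - 1"
      by (simp add: power2_eq_square eq_neg_iff_add_eq_0)
    then show ?thesis using finite_spanning_set_4 that unfolding 3 by blast
  qed
qed

theorem corollary2p3:
  fixes n :: nat and \<xi> :: "'k::field_char_0"
  assumes "n \<ge> 2"
    and "\<xi> ^ n = 1" and "\<forall>m. 0 < m \<and> m < n \<longrightarrow> \<xi> ^ m \<noteq> 1"
  shows "ring.finite_dimension (nichols_algebra n \<xi>) (nichols_scalars n \<xi>)
           (carrier (nichols_algebra n \<xi>)) \<longleftrightarrow> n \<le> 4"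
proof
  show "n \<le> 4" if "ring.finite_dimension (nichols_algebra n \<xi>) (nichols_scalars n \<xi>)
      (carrier (nichols_algebra n \<xi>))"
    using that infinite_dimension_if_gt_4[OF _ assms(2,3)] by (cases "n \<le> 4") auto
  assume "n \<le> 4"
  then obtain W where "finite W" "W \<subseteq> carrier (tensor_algebra n)"
    "carrier (tensor_algebra n) \<subseteq> pm.span (W \<union> deriv_radical n \<xi>)"
    using finite_spanning_set_le_4[OF assms(1) _ assms(2,3)] by blast
  then show "ring.finite_dimension (nichols_algebra n \<xi>) (nichols_scalars n \<xi>) (carrier (nichols_algebra n \<xi>))"
    using finite_dimension_nichols_algebra[of W n \<xi>] nichols_ideal_eq_deriv_radical[OF assms(2)] by simp
qed

end
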